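(* Let $A\in\mathbb{R}^{n\times n}$, let $k\ge 2$, and let $p(\lambda)=\lambda^k+c_1\lambda^{k-1}+\cdots+c_{k-1}\lambda+c_k$ be a polynomial with real coefficients such that $p(A)=0$. Let $C\in\mathbb{R}^{k\times k}$ be the companion matrix of $p$, and let $\mathcal{D}=\{t\in\mathbb{R}:\sigma(I-At)\cap(-\infty,0]=\emptyset\}$. Suppose that the vector function $[f_1(t),\ldots,f_k(t)]^T$ is the solution in $\mathcal{D}$ of the initial value problem $$(I-Ct)\,\dot{x}(t)=-e_2,\qquad x(0)=0,$$ where $e_2=[0\;1\;0\;\cdots\;0]^T\in\mathbb{R}^k$. Then, for all $t\in\mathcal{D}$, $$\log(I-At)=f_1(t)I+f_2(t)A+\cdots+f_k(t)A^{k-1}.$$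
   Context: $\sigma(X)$ denotes the spectrum (set of complex eigenvalues) of a matrix $X$, and $I$ is the identity matrix of the appropriate size. The set $\mathcal{D}$ is an open interval containing $0$. The companion matrix of $p(\lambda)=\lambda^k+c_1\lambda^{k-1}+\cdots+c_k$ is $$C=\begin{bmatrix}0&0&\cdots&0&-c_k\\1&0&\cdots&0&-c_{k-1}\\0&1&\cdots&0&-c_{k-2}\\ \vdots&&\ddots&&\vdots\\0&0&\cdots&1&-c_1\end{bmatrix},$$ that is, the first $k-1$ columns consist of a zero row on top of the identity matrix $I_{k-1}$, and the last column is $[-c_k,-c_{k-1},\ldots,-c_1]^T$. A solution in $\mathcal{D}$ of the initial value problem means a function $x:\mathcal{D}\to\mathbb{R}^k$, differentiable on $\mathcal{D}$, satisfying the equation at every $t\in\mathcal{D}$ and the initial condition at $t=0$. For a real square matrix $B$ with no eigenvalues on the closed negative real axis $(-\infty,0]$, $\log B$ denotes the principal logarithm of $B$: the unique real matrix $X$ with $e^X=B$ all of whose eigenvalues lie in the open strip $\{z\in\mathbb{C}:-\pi<\operatorname{Im} z<\pi\}$. *)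

theory Defs
  imports
    "Jordan_Normal_Form.Spectral_Radius"
    "HOL-Library.Nonpos_Ints"
begin

abbreviation complex_spectrum :: "real mat \<Rightarrow> complex set" where
  "complex_spectrum X \<equiv> spectrum (map_mat complex_of_real X)"

text \<open>The finite sum of the \<open>n \<times> n\<close> matrices \<open>a i \<cdot> A\<^sup>i\<close>. Matrices of type \<^typ>\<open>'a mat\<close> carry
  their dimensions as values, so the sum is taken in the module of \<open>n \<times> n\<close> matrices.\<close>

definition mat_power_sum :: "nat \<Rightarrow> nat set \<Rightarrow> (nat \<Rightarrow> 'a::comm_ring_1) \<Rightarrow> 'a mat \<Rightarrow> 'a mat" where
  "mat_power_sum n I a A = finsum (module_mat TYPE('a) n n) (\<lambda>i. a i \<cdot>\<^sub>m (A ^\<^sub>m i)) I"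

definition poly_mat :: "'a::comm_ring_1 poly \<Rightarrow> 'a mat \<Rightarrow> 'a mat" where
  "poly_mat p A = mat_power_sum (dim_row A) {..degree p} (coeff p) A"

text \<open>Indices start at \<open>0\<close>: for \<open>p = \<lambda>\<^sup>k + c\<^sub>1 \<lambda>\<^sup>k\<^sup>-\<^sup>1 + \<dots> + c\<^sub>k\<close>, row \<open>i\<close> of the last column holds
  \<open>- c\<^bsub>k-i\<^esub>\<close>, and \<open>c\<^bsub>k-i\<^esub> = coeff p i\<close>.\<close>

definition companion_mat :: "'a::comm_ring_1 poly \<Rightarrow> 'a mat" where
  "companion_mat p = mat (degree p) (degree p)
     (\<lambda>(i, j). if j = degree p - 1 then - coeff p i else if i = j + 1 then 1 else 0)"

text \<open>Only meaningful for square \<open>X\<close>; the exponential series is summed entrywise.\<close>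

definition mat_exp :: "'a::real_normed_field mat \<Rightarrow> 'a mat" where
  "mat_exp X = mat (dim_row X) (dim_row X) (\<lambda>ij. \<Sum>m. (X ^\<^sub>m m) $$ ij /\<^sub>R fact m)"

text \<open>Only meaningful for square \<open>B\<close> with no eigenvalues on the closed negative real axis.\<close>

definition principal_log :: "real mat \<Rightarrow> real mat" where
  "principal_log B = (THE X. X \<in> carrier_mat (dim_row B) (dim_row B) \<and> mat_exp X = B \<and>
     (\<forall>z\<in>complex_spectrum X. - pi < Im z \<and> Im z < pi))"

definition log_domain :: "real mat \<Rightarrow> real set" where
  "log_domain A = {t. complex_spectrum (1\<^sub>m (dim_row A) - t \<cdot>\<^sub>m A) \<inter> \<real>\<^sub>\<le>\<^sub>0 = {}}"

text \<open>\<open>x\<close> solves \<open>(I - C t) \<cdot> x'(t) = b\<close>, \<open>x(0) = 0\<close> on \<open>D\<close>. The equation is required at every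
  \<open>t \<in> D\<close>, including those (if any) where \<open>I - C t\<close> is singular. The vector \<open>v\<close> is the entrywise
  derivative of \<open>x\<close> at \<open>t\<close>.\<close>

definition ivp_solution :: "real set \<Rightarrow> real mat \<Rightarrow> real vec \<Rightarrow> (real \<Rightarrow> real vec) \<Rightarrow> bool" where
  "ivp_solution D C b x \<longleftrightarrow> (let k = dim_row C in
     x 0 = 0\<^sub>v k \<and>
     (\<forall>t\<in>D. x t \<in> carrier_vec k \<and>
       (\<exists>v\<in>carrier_vec k.
         (\<forall>i<k. ((\<lambda>s. x s $ i) has_real_derivative v $ i) (at t within D)) \<and>
         (1\<^sub>m k - t \<cdot>\<^sub>m C) *\<^sub>v v = b)))"

end

theory Submission
  imports Defs
begin

text \<open>Fix \<open>t\<close> in the domain and put \<open>X(s) = \<Sum> f\<^sub>l(s t) A\<^sup>l\<close> for \<open>0 \<le> s \<le> 1\<close>. Since \<open>p(A) = 0\<close>, the companion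
  system says \<open>X'(s) (1 - s t A) = - t A\<close>; as everything commutes, \<open>e\<^bsup>X(s)\<^esup> = 1 - s t A\<close>. An
  eigenvalue of \<open>X(1)\<close> is the endpoint of a continuous path \<open>g\<close> from \<open>0\<close> for which \<open>e\<^bsup>g(s)\<^esup>\<close> is an
  eigenvalue of \<open>1 - s t A\<close> and hence never in \<open>(-\<infinity>, 0]\<close>; so \<open>Im g\<close> cannot cross \<open>\<plusminus>\<pi>\<close>. Another
  logarithm \<open>Y\<close> with spectrum in the strip commutes with \<open>1 - t A\<close> and so with \<open>X = X(1)\<close>. Writing
  \<open>e\<^sup>X - e\<^sup>Y = G (X - Y)\<close> with the divided difference \<open>G\<close> of \<open>exp\<close>, the matrix \<open>G\<close> is injective, whence
  \<open>X = Y\<close>. The same divided difference yields the derivative of \<open>e\<^bsup>X(s)\<^esup>\<close>.\<close>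

section \<open>Invariant subspaces contain eigenvectors\<close>

text \<open>This is r(M) v by Horner's rule. Only products of \<open>M\<close> with vectors occur,
  and the recursion follows \<open>pCons\<close>, so induction over polynomials applies
  directly.\<close>

definition poly_apply :: "nat \<Rightarrow> 'a::comm_ring_1 mat \<Rightarrow> 'a vec \<Rightarrow> 'a poly \<Rightarrow> 'a vec" where
  "poly_apply n M v r = fold_coeffs (\<lambda>a w. a \<cdot>\<^sub>v v + M *\<^sub>v w) r (0\<^sub>v n)"

lemma mult_mat_vec_zero:
  "M \<in> carrier_mat n n \<Longrightarrow> M *\<^sub>v 0\<^sub>v n = (0\<^sub>v n :: 'a::comm_ring_1 vec)"
  by (rule eq_vecI) auto

lemma smult_vec_zero: "c \<cdot>\<^sub>v 0\<^sub>v n = (0\<^sub>v n :: 'a::comm_ring_1 vec)"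
  by (rule eq_vecI) auto

lemma smult_zero_vec: "0 \<cdot>\<^sub>v v = (0\<^sub>v (dim_vec v) :: 'a::comm_ring_1 vec)"
  by (rule eq_vecI) auto

context
  fixes M :: "'a::field mat" and v :: "'a vec" and n :: nat
  assumes M: "M \<in> carrier_mat n n" and v: "v \<in> carrier_vec n"
begin

lemma poly_apply_0: "poly_apply n M v 0 = 0\<^sub>v n"
  by (simp add: poly_apply_def)

lemma poly_apply_pCons:
  "poly_apply n M v (pCons a r) = a \<cdot>\<^sub>v v + M *\<^sub>v poly_apply n M v r"
\<comment> \<open>\<open>pCons 0 0\<close> is the zero polynomial and has an empty coefficient list,
  so the unfolding of the fold fails there and both sides are evaluated directly.\<close>
proof (cases "a = 0 \<and> r = 0")
  case True
  then show ?thesis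
    using M v by (simp add: poly_apply_0 mult_mat_vec_zero smult_zero_vec)
next
  case False
  then show ?thesis
    by (cases "a = 0") (simp_all add: poly_apply_def)
qed

lemma poly_apply_closed:
  assumes V: "V \<subseteq> carrier_vec n" "v \<in> V" "0\<^sub>v n \<in> V" "\<And>w. w \<in> V \<Longrightarrow> M *\<^sub>v w \<in> V"
    "\<And>a w. w \<in> V \<Longrightarrow> a \<cdot>\<^sub>v w \<in> V" "\<And>u w. u \<in> V \<Longrightarrow> w \<in> V \<Longrightarrow> u + w \<in> V"
  shows "poly_apply n M v r \<in> V"
  by (induction r) (auto simp: poly_apply_0 poly_apply_pCons V)

lemma poly_apply_carrier: "poly_apply n M v r \<in> carrier_vec n"
  using M v by (induction r) (auto simp: poly_apply_0 poly_apply_pCons)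

lemma poly_apply_smult: "poly_apply n M v (Polynomial.smult c r) = c \<cdot>\<^sub>v poly_apply n M v r"
proof (induction r)
  case 0
  then show ?case by (auto simp: poly_apply_0)
next
  case (pCons a r)
  show ?case
    using poly_apply_carrier[of r] M v
    by (simp add: poly_apply_pCons pCons.IH smult_add_distrib_vec[of _ n]
        mult_mat_vec[OF M poly_apply_carrier]
        smult_smult_assoc)
qed

lemma poly_apply_add: "poly_apply n M v (p + q) = poly_apply n M v p + poly_apply n M v q"
proof (induction p q rule: poly_induct2)
  case 0
  then show ?case by (simp add: poly_apply_0)
next
  case (pCons a p b q)
  have "M *\<^sub>v (poly_apply n M v p + poly_apply n M v q)
      = M *\<^sub>v poly_apply n M v p + M *\<^sub>v poly_apply n M v q"
    by (rule mult_add_distrib_mat_vec[OF M]) (rule poly_apply_carrier)+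
  then show ?case
    using poly_apply_carrier[of p] poly_apply_carrier[of q] M v
    unfolding add_pCons poly_apply_pCons pCons.IH
    by (intro eq_vecI) (simp_all add: algebra_simps)
qed

lemma poly_apply_linear_factor:
  "poly_apply n M v ([:- c, 1:] * q) = M *\<^sub>v poly_apply n M v q - c \<cdot>\<^sub>v poly_apply n M v q"
proof -
  have "[:- c, 1:] * q = pCons 0 q + Polynomial.smult (- c) q"
    by (simp add: add.commute)
  then have "poly_apply n M v ([:- c, 1:] * q)
      = poly_apply n M v (pCons 0 q) + poly_apply n M v (Polynomial.smult (- c) q)"
    by (simp only: poly_apply_add)
  then show ?thesis
    using M v poly_apply_carrier[of q]
    unfolding poly_apply_pCons poly_apply_smult by (intro eq_vecI) auto
qed

text \<open>Links Horner evaluation with the Krylov vectors, so that a kernel vector of the Krylov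
  matrix can be read as the coefficient list of an annihilating polynomial.\<close>

lemma poly_apply_Poly:
  assumes "i < n"
  shows "poly_apply n M v (Poly cs) $ i
    = (\<Sum>l<length cs. cs ! l * (((*\<^sub>v) M ^^ l) v) $ i)"
  using assms
proof (induction cs arbitrary: i)
  case Nil
  then show ?case by (simp add: poly_apply_0)
next
  case (Cons c cs)
  define u where "u l = ((*\<^sub>v) M ^^ l) v" for l
  have u: "u l \<in> carrier_vec n" for l
    by (induction l) (use M v in \<open>auto simp: u_def\<close>)
  have "(M *\<^sub>v poly_apply n M v (Poly cs)) $ i
      = (\<Sum>j<n. M $$ (i, j) * (\<Sum>l<length cs. cs ! l * u l $ j))"
    using Cons M poly_apply_carrier[of "Poly cs"]
    by (simp add: scalar_prod_def u_def lessThan_atLeast0)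
  also have "\<dots> = (\<Sum>l<length cs. cs ! l * (\<Sum>j<n. M $$ (i, j) * u l $ j))"
    unfolding sum_distrib_left by (subst sum.swap) (simp add: ac_simps)
  also have "\<dots> = (\<Sum>l<length cs. cs ! l * u (Suc l) $ i)"
    using Cons.prems M u by (intro sum.cong refl) (simp add: u_def scalar_prod_def lessThan_atLeast0
        carrier_vecD[OF u[unfolded u_def]])
  finally show ?case
    using Cons.prems M v poly_apply_carrier[of "Poly cs"]
    by (simp add: poly_apply_pCons sum.lessThan_Suc_shift u_def del: sum.lessThan_Suc)
qed

end

text \<open>Over the complex numbers r = (x - c) q for some root c. Put w = q(M) v, which lies in
  \<open>V\<close>. If w is nonzero, it is an eigenvector for c; otherwise q annihilates v and has
  smaller degree. A nonzero constant cannot annihilate v.\<close>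

lemma poly_apply_eigenvector:
  fixes M :: "complex mat"
  assumes M: "M \<in> carrier_mat n n" and V: "V \<subseteq> carrier_vec n" "v \<in> V" "v \<noteq> 0\<^sub>v n"
    and cl: "0\<^sub>v n \<in> V" "\<And>w. w \<in> V \<Longrightarrow> M *\<^sub>v w \<in> V" "\<And>a w. w \<in> V \<Longrightarrow> a \<cdot>\<^sub>v w \<in> V"
      "\<And>u w. u \<in> V \<Longrightarrow> w \<in> V \<Longrightarrow> u + w \<in> V"
    and r: "r \<noteq> 0" "poly_apply n M v r = 0\<^sub>v n"
  shows "\<exists>w\<in>V. w \<noteq> 0\<^sub>v n \<and> (\<exists>c. M *\<^sub>v w = c \<cdot>\<^sub>v w)"
  using r
proof (induction "degree r" arbitrary: r)
  case 0
  have v: "v \<in> carrier_vec n" using V by auto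
  from 0 obtain a where a: "r = [:a:]" "a \<noteq> 0"
    by (metis degree_0_id pCons_0_0)
  have "a \<cdot>\<^sub>v v = 0\<^sub>v n"
    using 0(3) M v unfolding a poly_apply_pCons[OF M v] poly_apply_0[OF M v]
    by (simp add: mult_mat_vec_zero)
  then have "v = 0\<^sub>v n"
    using a v by (auto simp: vec_eq_iff)
  with V show ?case by simp
next
  case (Suc d)
  have v: "v \<in> carrier_vec n" using V by auto
  from Suc.hyps(2) have "\<not> constant (poly r)"
    by (simp add: constant_degree)
  from fundamental_theorem_of_algebra[OF this] obtain c where "poly r c = 0" ..
  then obtain q where q: "r = [:- c, 1:] * q"
    by (auto simp: poly_eq_0_iff_dvd)
  define w where "w = poly_apply n M v q"
  have wV: "w \<in> V"
    unfolding w_def by (rule poly_apply_closed[OF M v]) (use V cl in auto)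
  then have w: "w \<in> carrier_vec n" using V by auto
  show ?case
  proof (cases "w = 0\<^sub>v n")
    case True
    from Suc.prems q have "q \<noteq> 0" by auto
    moreover from this have "degree r = Suc (degree q)"
      unfolding q by (subst degree_mult_eq) auto
    ultimately show ?thesis
      using Suc.hyps True unfolding w_def by auto
  next
    case False
    have "M *\<^sub>v w - c \<cdot>\<^sub>v w = 0\<^sub>v n"
      using Suc.prems(2) unfolding q poly_apply_linear_factor[OF M v] w_def by simp
    then have "M *\<^sub>v w = c \<cdot>\<^sub>v w"
      using M w by (auto simp: vec_eq_iff)
    with False wV show ?thesis by blast
  qed
qed

text \<open>The \<open>n + 1\<close> Krylov vectors \<open>v, M v, \<dots>, M\<^sup>n v\<close> are linearly dependent; padding them with a
  zero row gives a singular square matrix whose kernel yields the annihilating polynomial.\<close>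

lemma krylov_annihilator:
  fixes M :: "'a::field mat"
  assumes M: "M \<in> carrier_mat n n" and v: "v \<in> carrier_vec n"
  shows "\<exists>r. r \<noteq> 0 \<and> poly_apply n M v r = 0\<^sub>v n"
proof -
  define K where "K = mat (Suc n) (Suc n) (\<lambda>(i, j). if i = n then 0 else (((*\<^sub>v) M ^^ j) v) $ i)"
  have K: "K \<in> carrier_mat (Suc n) (Suc n)" by (simp add: K_def)
  \<comment> \<open>The zero row of \<open>K\<close> is a zero column of the transpose, which
    therefore kills the last unit vector; the determinant carries singularity back to
    \<open>K\<close>.\<close>
  have "transpose_mat K *\<^sub>v unit_vec (Suc n) n = 0\<^sub>v (Suc n)"
    by (rule eq_vecI) (simp_all add: K_def)
  then have "det (transpose_mat K) = 0"
    using det_0_iff_vec_prod_zero_field[of "transpose_mat K" "Suc n"] K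
    by (metis lessI transpose_carrier_mat unit_vec_carrier unit_vec_nonzero)
  then have "det K = 0" by (simp add: det_transpose[OF K])
  then obtain c where c: "c \<in> carrier_vec (Suc n)" "c \<noteq> 0\<^sub>v (Suc n)" "K *\<^sub>v c = 0\<^sub>v (Suc n)"
    using det_0_iff_vec_prod_zero_field[OF K] by auto
  define r where "r = Poly (list_of_vec c)"
  have "r \<noteq> 0"
  proof
    assume "r = 0"
    then have "nth_default 0 (list_of_vec c) i = 0" for i
      using coeff_Poly_eq[of "list_of_vec c"] by (simp add: r_def fun_eq_iff)
    then have "c $ i = 0" if "i < Suc n" for i
      using that c(1) by (metis carrier_vecD length_list_of_vec list_of_vec_index nth_default_nth)
    with c show False by (auto simp: vec_eq_iff)
  qed
  moreover have "poly_apply n M v r = 0\<^sub>v n"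
  proof (rule eq_vecI)
    fix i assume "i < dim_vec (0\<^sub>v n :: 'a vec)"
    then have i: "i < n" by simp
    have "(K *\<^sub>v c) $ i = 0" using c i by simp
    then have "(\<Sum>l<Suc n. (((*\<^sub>v) M ^^ l) v) $ i * c $ l) = 0"
      using i c(1) K by (simp add: scalar_prod_def K_def lessThan_atLeast0)
    then show "poly_apply n M v r $ i = 0\<^sub>v n $ i"
      using i c(1) unfolding r_def poly_apply_Poly[OF M v i]
      by (simp add: mult.commute list_of_vec_index)
  qed (use poly_apply_carrier[OF M v] in auto)
  ultimately show ?thesis by blast
qed

text \<open>Applied with \<open>V\<close> a kernel or an eigenspace of a matrix that commutes with
  \<open>M\<close>, this produces common eigenvectors.\<close>

lemma invariant_subspace_eigenvector:
  fixes M :: "complex mat"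
  assumes "M \<in> carrier_mat n n" "V \<subseteq> carrier_vec n" "v \<in> V" "v \<noteq> 0\<^sub>v n" "0\<^sub>v n \<in> V"
    "\<And>w. w \<in> V \<Longrightarrow> M *\<^sub>v w \<in> V" "\<And>a w. w \<in> V \<Longrightarrow> a \<cdot>\<^sub>v w \<in> V"
    "\<And>u w. u \<in> V \<Longrightarrow> w \<in> V \<Longrightarrow> u + w \<in> V"
  obtains w c where "w \<in> V" "w \<noteq> 0\<^sub>v n" "M *\<^sub>v w = c \<cdot>\<^sub>v w"
proof -
  obtain r where "r \<noteq> 0" "poly_apply n M v r = 0\<^sub>v n"
    using krylov_annihilator[OF assms(1)] assms(2,3) by blast
  from poly_apply_eigenvector[OF assms this] that show thesis by blast
qed

section \<open>Entrywise exponential generating series\<close>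

text \<open>The weights 1/m! are built in, so that the exponential and its divided difference are
  instances of one notion and share the lemmas below.\<close>

definition mat_sums :: "nat \<Rightarrow> (nat \<Rightarrow> 'a::real_normed_field mat) \<Rightarrow> 'a mat \<Rightarrow> bool" where
  "mat_sums n F S \<longleftrightarrow> S \<in> carrier_mat n n \<and> (\<forall>m. F m \<in> carrier_mat n n) \<and>
    (\<forall>i<n. \<forall>j<n. (\<lambda>m. F m $$ (i, j) /\<^sub>R fact m) sums S $$ (i, j))"

lemma index_mult_mat_sum:
  fixes A B :: "'a::comm_semiring_0 mat"
  assumes "A \<in> carrier_mat n n" "B \<in> carrier_mat n n" "i < n" "j < n"
  shows "(A * B) $$ (i, j) = (\<Sum>l<n. A $$ (i, l) * B $$ (l, j))"
  using assms by (simp add: scalar_prod_def lessThan_atLeast0)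

lemma index_mult_mat_vec_sum:
  fixes A :: "'a::comm_semiring_0 mat"
  assumes "A \<in> carrier_mat n n" "v \<in> carrier_vec n" "i < n"
  shows "(A *\<^sub>v v) $ i = (\<Sum>l<n. A $$ (i, l) * v $ l)"
  using assms by (simp add: scalar_prod_def lessThan_atLeast0)

lemma mat_sums_unique:
  assumes "mat_sums n F S" "mat_sums n F T"
  shows "S = T"
proof (rule eq_matI)
  fix i j assume "i < dim_row T" "j < dim_col T"
  then show "S $$ (i, j) = T $$ (i, j)"
    using assms unfolding mat_sums_def by (metis carrier_matD sums_unique2)
qed (use assms in \<open>auto simp: mat_sums_def\<close>)

lemma mat_sums_mult_left:
  assumes "mat_sums n F S" "B \<in> carrier_mat n n"
  shows "mat_sums n (\<lambda>m. B * F m) (B * S)"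
proof -
  have "(\<lambda>m. (B * F m) $$ (i, j) /\<^sub>R fact m) sums (B * S) $$ (i, j)" if ij: "i < n" "j < n" for i j
  proof -
    have "(\<lambda>m. \<Sum>l<n. B $$ (i, l) * (F m $$ (l, j) /\<^sub>R fact m)) sums (\<Sum>l<n. B $$ (i, l) * S $$ (l, j))"
      using assms ij unfolding mat_sums_def by (intro sums_sum sums_mult) auto
    moreover have "(\<Sum>l<n. B $$ (i, l) * (F m $$ (l, j) /\<^sub>R fact m)) = (B * F m) $$ (i, j) /\<^sub>R fact m" for m
      using assms ij unfolding mat_sums_def
      by (subst index_mult_mat_sum[of _ n]) (auto simp: scaleR_sum_right)
    ultimately show ?thesis
      using assms ij unfolding mat_sums_def by (subst index_mult_mat_sum[of _ n]) auto
  qed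
  with assms show ?thesis
    unfolding mat_sums_def by (auto simp del: index_mult_mat(1) intro!: mult_carrier_mat)
qed

lemma mat_sums_mult_right:
  assumes "mat_sums n F S" "B \<in> carrier_mat n n"
  shows "mat_sums n (\<lambda>m. F m * B) (S * B)"
proof -
  have "(\<lambda>m. (F m * B) $$ (i, j) /\<^sub>R fact m) sums (S * B) $$ (i, j)" if ij: "i < n" "j < n" for i j
  proof -
    have "(\<lambda>m. \<Sum>l<n. (F m $$ (i, l) /\<^sub>R fact m) * B $$ (l, j)) sums (\<Sum>l<n. S $$ (i, l) * B $$ (l, j))"
      using assms ij unfolding mat_sums_def by (intro sums_sum sums_mult2) auto
    moreover have "(\<Sum>l<n. (F m $$ (i, l) /\<^sub>R fact m) * B $$ (l, j)) = (F m * B) $$ (i, j) /\<^sub>R fact m" for m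
      using assms ij unfolding mat_sums_def
      by (subst index_mult_mat_sum[of _ n]) (auto simp: scaleR_sum_right)
    ultimately show ?thesis
      using assms ij unfolding mat_sums_def by (subst index_mult_mat_sum[of _ n]) auto
  qed
  with assms show ?thesis
    unfolding mat_sums_def by (auto simp del: index_mult_mat(1) intro!: mult_carrier_mat)
qed

lemma mat_sums_diff:
  assumes "mat_sums n F S" "mat_sums n G T"
  shows "mat_sums n (\<lambda>m. F m - G m) (S - T)"
proof -
  have "(\<lambda>m. F m $$ (i, j) /\<^sub>R fact m - G m $$ (i, j) /\<^sub>R fact m) sums (S $$ (i, j) - T $$ (i, j))"
    if "i < n" "j < n" for i j
    using assms that unfolding mat_sums_def by (intro sums_diff) auto
  moreover have "F m \<in> carrier_mat n n" "G m \<in> carrier_mat n n" for m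
    using assms unfolding mat_sums_def by auto
  ultimately show ?thesis
    using assms unfolding mat_sums_def
    by (auto simp: minus_carrier_mat scaleR_diff_right carrier_matD[where nr = n and nc = n])
qed

lemma mat_sums_commute:
  assumes "mat_sums n F S" "B \<in> carrier_mat n n" "\<And>m. B * F m = F m * B"
  shows "B * S = S * B"
  using mat_sums_unique[OF mat_sums_mult_left[OF assms(1,2)]] mat_sums_mult_right[OF assms(1,2)]
    assms(3) by simp

lemma mat_sums_mult_vec:
  assumes "mat_sums n F S" "v \<in> carrier_vec n" "i < n"
  shows "(\<lambda>m. (F m *\<^sub>v v) $ i /\<^sub>R fact m) sums (S *\<^sub>v v) $ i"
proof -
  have "(\<lambda>m. \<Sum>l<n. (F m $$ (i, l) /\<^sub>R fact m) * v $ l) sums (\<Sum>l<n. S $$ (i, l) * v $ l)"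
    using assms unfolding mat_sums_def by (intro sums_sum sums_mult2) auto
  moreover have "(\<Sum>l<n. (F m $$ (i, l) /\<^sub>R fact m) * v $ l) = (F m *\<^sub>v v) $ i /\<^sub>R fact m" for m
    using assms unfolding mat_sums_def
    by (subst index_mult_mat_vec_sum[of _ n]) (auto simp: scaleR_sum_right)
  ultimately show ?thesis
    using assms unfolding mat_sums_def by (subst index_mult_mat_vec_sum[of _ n]) auto
qed

section \<open>Divided differences of the exponential\<close>

text \<open>This is the sum of X^i Y^(m-1-i) over i < m, which for commuting arguments is the
  divided difference (X^m - Y^m)/(X - Y).\<close>

primrec diff_quot_pow :: "'a::comm_ring_1 mat \<Rightarrow> 'a mat \<Rightarrow> nat \<Rightarrow> 'a mat" where
  "diff_quot_pow X Y 0 = 0\<^sub>m (dim_row X) (dim_row X)"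
| "diff_quot_pow X Y (Suc m) = X ^\<^sub>m m + diff_quot_pow X Y m * Y"

text \<open>For commuting arguments this is (e^X - e^Y)/(X - Y), given by a series that makes sense
  even when X - Y is singular.\<close>

definition diff_quot_exp :: "'a::real_normed_field mat \<Rightarrow> 'a mat \<Rightarrow> 'a mat" where
  "diff_quot_exp X Y = mat (dim_row X) (dim_row X)
     (\<lambda>ij. \<Sum>m. diff_quot_pow X Y m $$ ij /\<^sub>R fact m)"

lemma diff_quot_pow_carrier [simp]:
  "X \<in> carrier_mat n n \<Longrightarrow> Y \<in> carrier_mat n n \<Longrightarrow> diff_quot_pow X Y m \<in> carrier_mat n n"
  by (induction m) auto

lemma pow_mat_commute:
  fixes X Y :: "'a::comm_ring_1 mat"
  assumes "X \<in> carrier_mat n n" "Y \<in> carrier_mat n n" "Y * X = X * Y"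
  shows "Y * X ^\<^sub>m m = X ^\<^sub>m m * Y"
proof (induction m)
  case (Suc m)
  have "Y * (X ^\<^sub>m m * X) = (X ^\<^sub>m m * Y) * X"
    using assms Suc by (simp flip: assoc_mult_mat[of _ n n _ n _ n])
  also have "\<dots> = X ^\<^sub>m m * X * Y"
    using assms by (simp add: assoc_mult_mat[of _ n n _ n _ n])
  finally show ?case by simp
qed (use assms in simp)

text \<open>Passing to the series, this makes the kernel of the divided difference invariant under X
  and Y when these commute.\<close>

lemma diff_quot_pow_commute:
  fixes X Y Z :: "'a::comm_ring_1 mat"
  assumes X: "X \<in> carrier_mat n n" and Y: "Y \<in> carrier_mat n n" and Z: "Z \<in> carrier_mat n n"
    and "Z * X = X * Z" "Z * Y = Y * Z"
  shows "Z * diff_quot_pow X Y m = diff_quot_pow X Y m * Z"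
proof (induction m)
  case (Suc m)
  let ?S = "diff_quot_pow X Y m"
  have S: "?S \<in> carrier_mat n n" using X Y by simp
  have SY: "?S * Y \<in> carrier_mat n n" using S Y by simp
  have "Z * (?S * Y) = ?S * Z * Y"
    unfolding Suc[symmetric] by (rule assoc_mult_mat[OF Z S Y, symmetric])
  also have "\<dots> = ?S * (Y * Z)"
    unfolding assms(5)[symmetric] by (rule assoc_mult_mat[OF S Z Y])
  also have "\<dots> = ?S * Y * Z"
    by (rule assoc_mult_mat[OF S Y Z, symmetric])
  finally show ?case
    using pow_mat_commute[OF X Z assms(4), of m]
    by (simp add: mult_add_distrib_mat[OF Z pow_carrier_mat[OF X] SY]
        add_mult_distrib_mat[OF pow_carrier_mat[OF X] SY Z])
qed (use assms in simp)

text \<open>With S the m-th divided difference, commutativity moves Y past X - Y, and the recursion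
  telescopes: (X^m + S Y)(X - Y) = X^(m+1) - X^m Y + (X^m - Y^m) Y.\<close>

lemma diff_quot_pow_mult:
  fixes X Y :: "'a::comm_ring_1 mat"
  assumes X: "X \<in> carrier_mat n n" and Y: "Y \<in> carrier_mat n n" and XY: "Y * X = X * Y"
  shows "diff_quot_pow X Y m * (X - Y) = X ^\<^sub>m m - Y ^\<^sub>m m"
proof (induction m)
  case 0
  then show ?case using X Y by (simp add: minus_r_inv_mat[OF one_carrier_mat])
next
  case (Suc m)
  let ?S = "diff_quot_pow X Y m"
  have c: "?S \<in> carrier_mat n n" "X - Y \<in> carrier_mat n n" "X ^\<^sub>m m \<in> carrier_mat n n"
    "Y ^\<^sub>m m \<in> carrier_mat n n"
    using X Y by (auto simp: minus_carrier_mat)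
  have "Y * (X - Y) = (X - Y) * Y"
    unfolding mult_minus_distrib_mat[OF Y X Y] minus_mult_distrib_mat[OF X Y Y] XY ..
  then have "?S * Y * (X - Y) = ?S * ((X - Y) * Y)"
    by (simp add: assoc_mult_mat[OF c(1) Y c(2)])
  also have "\<dots> = ?S * (X - Y) * Y"
    by (rule assoc_mult_mat[OF c(1,2) Y, symmetric])
  also have "\<dots> = X ^\<^sub>m m * Y - Y ^\<^sub>m m * Y"
    unfolding Suc by (rule minus_mult_distrib_mat[OF c(3,4) Y])
  finally have "diff_quot_pow X Y (Suc m) * (X - Y)
      = X ^\<^sub>m m * X - X ^\<^sub>m m * Y + (X ^\<^sub>m m * Y - Y ^\<^sub>m m * Y)"
    unfolding diff_quot_pow.simps
    by (simp add: add_mult_distrib_mat[OF c(3) mult_carrier_mat[OF c(1) Y] c(2)]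
        mult_minus_distrib_mat[OF c(3) X Y])
  also have "\<dots> = X ^\<^sub>m Suc m - Y ^\<^sub>m Suc m"
    by (rule eq_matI) (use X Y c in \<open>auto simp del: index_mult_mat(1)\<close>)
  finally show ?case .
qed

section \<open>Entrywise bounds and convergence of the series\<close>

lemma norm_mult_entry_le:
  fixes P Q :: "'a::real_normed_field mat"
  assumes P: "P \<in> carrier_mat n n" and Q: "Q \<in> carrier_mat n n" and ij: "i < n" "j < n"
    and p: "\<And>i j. i < n \<Longrightarrow> j < n \<Longrightarrow> norm (P $$ (i, j)) \<le> p"
    and q: "\<And>i j. i < n \<Longrightarrow> j < n \<Longrightarrow> norm (Q $$ (i, j)) \<le> q"
  shows "norm ((P * Q) $$ (i, j)) \<le> real n * q * p"
proof -
  have "0 \<le> p" using p[OF ij] norm_ge_zero order_trans by blast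
  have "norm ((P * Q) $$ (i, j)) \<le> (\<Sum>l<n. norm (P $$ (i, l) * Q $$ (l, j)))"
    unfolding index_mult_mat_sum[OF P Q ij] by (rule norm_sum)
  also have "\<dots> \<le> (\<Sum>l<n. p * q)"
    unfolding norm_mult using p q ij \<open>0 \<le> p\<close> by (intro sum_mono mult_mono) auto
  finally show ?thesis by (simp add: ac_simps)
qed

lemma norm_pow_entry_le:
  fixes X :: "'a::real_normed_field mat"
  assumes X: "X \<in> carrier_mat n n" and ij: "i < n" "j < n"
    and x: "\<And>i j. i < n \<Longrightarrow> j < n \<Longrightarrow> norm (X $$ (i, j)) \<le> c"
  shows "norm ((X ^\<^sub>m m) $$ (i, j)) \<le> (real n * c) ^ m"
  using ij
proof (induction m arbitrary: i j)
  case (Suc m)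
  have "norm ((X ^\<^sub>m m * X) $$ (i, j)) \<le> real n * c * (real n * c) ^ m"
    using norm_mult_entry_le[OF pow_carrier_mat[OF X] X Suc.prems Suc.IH x] by simp
  then show ?case by simp
qed (use X in simp)

text \<open>The factor 2 absorbs the growing number of summands: with K = n c >= 1, the recursion
  gives K^m + K (2K)^m <= (2K)^(m+1). A geometric bound is enough to compare with an exponential
  series.\<close>

lemma norm_diff_quot_pow_entry_le:
  fixes X Y :: "'a::real_normed_field mat"
  assumes X: "X \<in> carrier_mat n n" and Y: "Y \<in> carrier_mat n n" and ij: "i < n" "j < n"
    and x: "\<And>i j. i < n \<Longrightarrow> j < n \<Longrightarrow> norm (X $$ (i, j)) \<le> c"
    and y: "\<And>i j. i < n \<Longrightarrow> j < n \<Longrightarrow> norm (Y $$ (i, j)) \<le> c"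
    and c: "1 \<le> c"
  shows "norm (diff_quot_pow X Y m $$ (i, j)) \<le> (2 * (real n * c)) ^ m"
  using ij
proof (induction m arbitrary: i j)
  case (Suc m)
  let ?K = "real n * c"
  have "1 \<le> ?K" using Suc.prems c mult_mono[of 1 "real n" 1 c] by simp
  have "norm (diff_quot_pow X Y (Suc m) $$ (i, j))
      \<le> norm ((X ^\<^sub>m m) $$ (i, j)) + norm ((diff_quot_pow X Y m * Y) $$ (i, j))"
    using X Y Suc.prems
    by (simp add: norm_triangle_ineq carrier_matD[OF diff_quot_pow_carrier[OF X Y]]
        del: index_mult_mat(1))
  also have "\<dots> \<le> ?K ^ m + ?K * (2 * ?K) ^ m"
    by (intro add_mono norm_pow_entry_le[OF X Suc.prems x]
        norm_mult_entry_le[OF diff_quot_pow_carrier[OF X Y] Y Suc.prems Suc.IH y])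
  also have "\<dots> \<le> ?K * (2 * ?K) ^ m + ?K * (2 * ?K) ^ m"
  proof -
    have "1 * K ^ m \<le> K * (2 * K) ^ m" if "1 \<le> K" for K :: real
      using that by (intro mult_mono power_mono) auto
    from this[OF \<open>1 \<le> ?K\<close>] show ?thesis by (simp only: mult_1_left add_right_mono)
  qed
  also have "\<dots> = (2 * ?K) ^ Suc m" by simp
  finally show ?case .
qed (use X in simp)

lemma mat_entries_bounded:
  fixes X :: "'a::real_normed_field mat"
  obtains c where "1 \<le> c" "\<And>i j. i < n \<Longrightarrow> j < n \<Longrightarrow> norm (X $$ (i, j)) \<le> c"
proof
  \<comment> \<open>The summand 1 secures the lower bound on c that
    \<open>norm_diff_quot_pow_entry_le\<close> asks for.\<close>
  let ?c = "1 + (\<Sum>(i, j)\<in>{..<n} \<times> {..<n}. norm (X $$ (i, j)))"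
  show "1 \<le> ?c" by (simp add: sum_nonneg split_beta)
  show "norm (X $$ (i, j)) \<le> ?c" if "i < n" "j < n" for i j
    using member_le_sum[of "(i, j)" "{..<n} \<times> {..<n}" "\<lambda>(i, j). norm (X $$ (i, j))"] that
    by force
qed

lemma mat_exp_sums:
  fixes X :: "'a::{real_normed_field, banach} mat"
  assumes X: "X \<in> carrier_mat n n"
  shows "mat_sums n (\<lambda>m. X ^\<^sub>m m) (mat_exp X)"
proof -
  obtain c where c: "\<And>i j. i < n \<Longrightarrow> j < n \<Longrightarrow> norm (X $$ (i, j)) \<le> c"
    using mat_entries_bounded by metis
  have "summable (\<lambda>m. (X ^\<^sub>m m) $$ (i, j) /\<^sub>R fact m)" if "i < n" "j < n" for i j
    by (rule summable_comparison_test'[OF summable_exp[of "real n * c"]])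
      (use norm_pow_entry_le[OF X that c] in \<open>auto simp: divide_simps\<close>)
  with X show ?thesis
    by (auto simp: mat_sums_def mat_exp_def intro: summable_sums)
qed

lemma diff_quot_exp_sums:
  fixes X Y :: "'a::{real_normed_field, banach} mat"
  assumes X: "X \<in> carrier_mat n n" and Y: "Y \<in> carrier_mat n n"
  shows "mat_sums n (diff_quot_pow X Y) (diff_quot_exp X Y)"
proof -
  obtain a b where "1 \<le> a" "1 \<le> b" and a: "\<And>i j. i < n \<Longrightarrow> j < n \<Longrightarrow> norm (X $$ (i, j)) \<le> a"
    and b: "\<And>i j. i < n \<Longrightarrow> j < n \<Longrightarrow> norm (Y $$ (i, j)) \<le> b"
    using mat_entries_bounded by metis
  let ?c = "max a b"
  have c: "norm (X $$ (i, j)) \<le> ?c" "norm (Y $$ (i, j)) \<le> ?c" "1 \<le> ?c" if "i < n" "j < n" for i j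
    using a[OF that] b[OF that] \<open>1 \<le> a\<close> by auto
  have "summable (\<lambda>m. diff_quot_pow X Y m $$ (i, j) /\<^sub>R fact m)" if "i < n" "j < n" for i j
    by (rule summable_comparison_test'[OF summable_exp[of "2 * (real n * ?c)"]])
      (use norm_diff_quot_pow_entry_le[OF X Y that c(1,2) c(3)[OF that]] in \<open>auto simp: divide_simps\<close>)
  with X Y show ?thesis
    by (auto simp: mat_sums_def diff_quot_exp_def intro: summable_sums)
qed

lemma mat_exp_carrier [simp]: "X \<in> carrier_mat n n \<Longrightarrow> mat_exp X \<in> carrier_mat n n"
  by (simp add: mat_exp_def)

lemma diff_quot_exp_carrier [simp]: "X \<in> carrier_mat n n \<Longrightarrow> diff_quot_exp X Y \<in> carrier_mat n n"
  by (simp add: diff_quot_exp_def)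

lemma diff_quot_exp_mult:
  fixes X Y :: "'a::{real_normed_field, banach} mat"
  assumes X: "X \<in> carrier_mat n n" and Y: "Y \<in> carrier_mat n n" and XY: "Y * X = X * Y"
  shows "diff_quot_exp X Y * (X - Y) = mat_exp X - mat_exp Y"
proof (rule mat_sums_unique)
  show "mat_sums n (\<lambda>m. diff_quot_pow X Y m * (X - Y)) (diff_quot_exp X Y * (X - Y))"
    using mat_sums_mult_right[OF diff_quot_exp_sums[OF X Y]] Y by (simp add: minus_carrier_mat)
  show "mat_sums n (\<lambda>m. diff_quot_pow X Y m * (X - Y)) (mat_exp X - mat_exp Y)"
    unfolding diff_quot_pow_mult[OF X Y XY] by (rule mat_sums_diff mat_exp_sums X Y)+
qed

text \<open>Since (m+1)/(m+1)! = 1/m!, this is termwise differentiation of an exponential series. It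
  evaluates divided differences at coinciding arguments.\<close>

lemma sums_shift_fact:
  fixes a :: "nat \<Rightarrow> 'a::real_normed_vector"
  assumes "b 0 = 0" "\<And>m. b (Suc m) = real (Suc m) *\<^sub>R a m" "(\<lambda>m. a m /\<^sub>R fact m) sums s"
  shows "(\<lambda>m. b m /\<^sub>R fact m) sums s"
proof -
  have "(\<lambda>m. b (Suc m) /\<^sub>R fact (Suc m)) = (\<lambda>m. a m /\<^sub>R fact m)"
    unfolding assms(2) by (simp add: divide_simps del: of_nat_Suc)
  with assms(3) have "(\<lambda>m. b (Suc m) /\<^sub>R fact (Suc m)) sums s" by simp
  then show ?thesis
    using assms(1) by (subst (asm) sums_Suc_iff) simp
qed

lemma diff_quot_pow_same:
  fixes X :: "real mat"
  assumes X: "X \<in> carrier_mat n n"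
  shows "diff_quot_pow X X (Suc m) = real (Suc m) \<cdot>\<^sub>m X ^\<^sub>m m"
proof (induction m)
  case 0
  then show ?case using X by (intro eq_matI) auto
next
  case (Suc m)
  have "diff_quot_pow X X (Suc (Suc m)) = X ^\<^sub>m Suc m + real (Suc m) \<cdot>\<^sub>m X ^\<^sub>m Suc m"
    unfolding diff_quot_pow.simps(2)[of X X "Suc m"] Suc using X
    by (simp add: mult_smult_assoc_mat[of _ n n])
  also have "\<dots> = real (Suc (Suc m)) \<cdot>\<^sub>m X ^\<^sub>m Suc m"
    by (rule eq_matI) (use X in \<open>auto simp: algebra_simps simp del: index_mult_mat(1)\<close>)
  finally show ?case .
qed

text \<open>On the diagonal a divided difference becomes the derivative: the terms are m X^(m-1),
  and the derivative of exp is exp.\<close>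

lemma diff_quot_exp_same:
  fixes X :: "real mat"
  assumes X: "X \<in> carrier_mat n n"
  shows "diff_quot_exp X X = mat_exp X"
proof (rule mat_sums_unique[OF diff_quot_exp_sums[OF X X]])
  have "(\<lambda>m. diff_quot_pow X X m $$ (i, j) /\<^sub>R fact m) sums mat_exp X $$ (i, j)"
    if ij: "i < n" "j < n" for i j
  proof (rule sums_shift_fact[where a = "\<lambda>m. (X ^\<^sub>m m) $$ (i, j)"])
    show "diff_quot_pow X X 0 $$ (i, j) = 0" using X ij by simp
    show "diff_quot_pow X X (Suc m) $$ (i, j) = real (Suc m) *\<^sub>R (X ^\<^sub>m m) $$ (i, j)" for m
      unfolding diff_quot_pow_same[OF X] using X ij by simp
    show "(\<lambda>m. (X ^\<^sub>m m) $$ (i, j) /\<^sub>R fact m) sums mat_exp X $$ (i, j)"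
      using mat_exp_sums[OF X] ij by (simp add: mat_sums_def)
  qed
  with X show "mat_sums n (diff_quot_pow X X) (mat_exp X)"
    by (simp add: mat_sums_def del: diff_quot_pow.simps)
qed

section \<open>The derivative of the exponential along a commuting path\<close>

text \<open>Tannery's theorem along a filter. Beyond some N the tails of both series are below e/3
  by the common majorant, and the remaining finite sums converge.\<close>

lemma tendsto_suminf_dominated:
  fixes a :: "'b \<Rightarrow> nat \<Rightarrow> real"
  assumes lim: "\<And>m. ((\<lambda>x. a x m) \<longlongrightarrow> b m) F"
    and bound: "\<forall>\<^sub>F x in F. \<forall>m. norm (a x m) \<le> M m" and M: "summable M"
  shows "((\<lambda>x. \<Sum>m. a x m) \<longlongrightarrow> (\<Sum>m. b m)) F"
\<comment> \<open>The majorant passes to the limits \<open>b m\<close> only along a nontrivial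
  filter; along the trivial one every limit statement holds.\<close>
proof (cases "F = bot")
  case False
  have b: "norm (b m) \<le> M m" for m
    by (rule tendsto_upperbound[OF tendsto_norm[OF lim] _ False])
      (use bound in \<open>auto elim: eventually_mono\<close>)
  show ?thesis
  proof (rule tendstoI)
    fix e :: real assume "0 < e"
    then obtain N where N: "norm (\<Sum>m. M (m + N)) < e / 3"
      using suminf_exist_split[OF _ M, of "e / 3"] by auto
    have tail: "norm (\<Sum>m. c (m + N)) < e / 3 \<and> (\<Sum>m. c m) = (\<Sum>m. c (m + N)) + (\<Sum>m<N. c m)"
      if "\<forall>m. norm (c m) \<le> M m" for c :: "nat \<Rightarrow> real"
    proof
      have "norm (\<Sum>m. c (m + N)) \<le> (\<Sum>m. M (m + N))"
        by (rule norm_suminf_le) (use that M in \<open>auto simp: summable_iff_shift\<close>)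
      with N show "norm (\<Sum>m. c (m + N)) < e / 3" by simp
      have "summable c"
        using summable_comparison_test'[OF M, of 0 c] that by simp
      from suminf_split_initial_segment[OF this]
      show "(\<Sum>m. c m) = (\<Sum>m. c (m + N)) + (\<Sum>m<N. c m)" .
    qed
    have "((\<lambda>x. \<Sum>m<N. a x m) \<longlongrightarrow> (\<Sum>m<N. b m)) F"
      by (intro tendsto_sum lim)
    then have "\<forall>\<^sub>F x in F. dist (\<Sum>m<N. a x m) (\<Sum>m<N. b m) < e / 3"
      by (rule tendstoD) (use \<open>0 < e\<close> in simp)
    with bound show "\<forall>\<^sub>F x in F. dist (\<Sum>m. a x m) (\<Sum>m. b m) < e"
    proof eventually_elim
      case (elim x)
      have "\<forall>m. norm (b m) \<le> M m" using b by blast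
      from tail[OF elim(1)] tail[OF this] elim(2) show ?case
        unfolding dist_real_def real_norm_def by linarith
    qed
  qed
qed simp

lemma index_mult_mat_tendsto:
  fixes X Y :: "'b \<Rightarrow> real mat"
  assumes "\<And>x. X x \<in> carrier_mat n n" "\<And>x. Y x \<in> carrier_mat n n"
    "L \<in> carrier_mat n n" "K \<in> carrier_mat n n"
    "\<And>i j. i < n \<Longrightarrow> j < n \<Longrightarrow> ((\<lambda>x. X x $$ (i, j)) \<longlongrightarrow> L $$ (i, j)) F"
    "\<And>i j. i < n \<Longrightarrow> j < n \<Longrightarrow> ((\<lambda>x. Y x $$ (i, j)) \<longlongrightarrow> K $$ (i, j)) F"
    "i < n" "j < n"
  shows "((\<lambda>x. (X x * Y x) $$ (i, j)) \<longlongrightarrow> (L * K) $$ (i, j)) F"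
  unfolding index_mult_mat_sum[OF assms(1,2,7,8)] index_mult_mat_sum[OF assms(3,4,7,8)]
  using assms(5-8) by (intro tendsto_sum tendsto_mult) auto

context
  fixes X :: "'b \<Rightarrow> real mat" and L :: "real mat" and F :: "'b filter" and n :: nat
  assumes X: "\<And>x. X x \<in> carrier_mat n n" and L: "L \<in> carrier_mat n n"
    and lim: "\<And>i j. i < n \<Longrightarrow> j < n \<Longrightarrow> ((\<lambda>x. X x $$ (i, j)) \<longlongrightarrow> L $$ (i, j)) F"
begin

lemma pow_mat_tendsto:
  "i < n \<Longrightarrow> j < n \<Longrightarrow> ((\<lambda>x. (X x ^\<^sub>m m) $$ (i, j)) \<longlongrightarrow> (L ^\<^sub>m m) $$ (i, j)) F"
proof (induction m arbitrary: i j)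
  case 0
  then show ?case using carrier_matD[OF X] L by simp
next
  case (Suc m)
  show ?case
    unfolding pow_mat.simps
    by (rule index_mult_mat_tendsto[OF pow_carrier_mat[OF X] X pow_carrier_mat[OF L] L Suc.IH lim])
      (use Suc.prems in auto)
qed

lemma diff_quot_pow_tendsto:
  "i < n \<Longrightarrow> j < n \<Longrightarrow>
    ((\<lambda>x. diff_quot_pow (X x) L m $$ (i, j)) \<longlongrightarrow> diff_quot_pow L L m $$ (i, j)) F"
proof (induction m arbitrary: i j)
  case 0
  then show ?case using carrier_matD[OF X] L by simp
next
  case (Suc m)
  have c: "diff_quot_pow (X x) L m * L \<in> carrier_mat n n" "diff_quot_pow L L m * L \<in> carrier_mat n n" for x
    using diff_quot_pow_carrier X L by (auto intro!: mult_carrier_mat)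
  have "((\<lambda>x. (diff_quot_pow (X x) L m * L) $$ (i, j)) \<longlongrightarrow> (diff_quot_pow L L m * L) $$ (i, j)) F"
    by (rule index_mult_mat_tendsto[OF diff_quot_pow_carrier[OF X L] L diff_quot_pow_carrier[OF L L] L Suc.IH])
      (use Suc.prems in auto)
  then have "((\<lambda>x. (X x ^\<^sub>m m) $$ (i, j) + (diff_quot_pow (X x) L m * L) $$ (i, j))
      \<longlongrightarrow> (L ^\<^sub>m m) $$ (i, j) + (diff_quot_pow L L m * L) $$ (i, j)) F"
    by (intro tendsto_add pow_mat_tendsto Suc.prems)
  then show ?case
    unfolding diff_quot_pow.simps
    using carrier_matD[OF c(1)] carrier_matD[OF c(2)] Suc.prems
    by (simp add: index_add_mat(1) del: index_mult_mat)
qed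

text \<open>Continuity of the divided difference at the diagonal. Eventually the entries of
  \<open>X x\<close> are bounded by c + 1, so the terms have a majorant K^m/m! independent of x, and
  Tannery's theorem applies.\<close>

lemma diff_quot_exp_tendsto:
  assumes ij: "i < n" "j < n"
  shows "((\<lambda>x. diff_quot_exp (X x) L $$ (i, j)) \<longlongrightarrow> mat_exp L $$ (i, j)) F"
proof -
  obtain c where c: "1 \<le> c" "\<And>i j. i < n \<Longrightarrow> j < n \<Longrightarrow> norm (L $$ (i, j)) \<le> c"
    using mat_entries_bounded by metis
  let ?K = "2 * (real n * (c + 1))"
  have "\<forall>\<^sub>F x in F. norm (X x $$ (i, j)) \<le> c + 1" if "i < n" "j < n" for i j
  proof -
    have "\<forall>\<^sub>F x in F. norm (X x $$ (i, j)) < c + 1"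
      by (rule order_tendstoD(2)[OF tendsto_norm[OF lim[OF that]]]) (use c(2)[OF that] in simp)
    then show ?thesis by (rule eventually_mono) simp
  qed
  then have "\<forall>\<^sub>F x in F. \<forall>i\<in>{..<n}. \<forall>j\<in>{..<n}. norm (X x $$ (i, j)) \<le> c + 1"
    by (intro eventually_ball_finite ballI finite_lessThan) auto
  then have bound: "\<forall>\<^sub>F x in F. \<forall>m. norm (diff_quot_pow (X x) L m $$ (i, j) /\<^sub>R fact m) \<le> inverse (fact m) * ?K ^ m"
  proof eventually_elim
    case (elim x)
    have "norm (L $$ (i, j)) \<le> c + 1" if "i < n" "j < n" for i j
      using c(2)[OF that] by linarith
    then have "norm (diff_quot_pow (X x) L m $$ (i, j)) \<le> ?K ^ m" for m
      using elim c(1) by (intro norm_diff_quot_pow_entry_le[OF X L ij]) auto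
    then show ?case by (simp add: divide_simps)
  qed
  have "((\<lambda>x. \<Sum>m. diff_quot_pow (X x) L m $$ (i, j) /\<^sub>R fact m)
      \<longlongrightarrow> (\<Sum>m. diff_quot_pow L L m $$ (i, j) /\<^sub>R fact m)) F"
    by (rule tendsto_suminf_dominated[OF _ bound summable_exp])
      (intro tendsto_scaleR tendsto_const diff_quot_pow_tendsto ij)
  moreover have "(\<Sum>m. diff_quot_pow L L m $$ (i, j) /\<^sub>R fact m) = mat_exp L $$ (i, j)"
    using L ij by (simp flip: diff_quot_exp_same[OF L] add: diff_quot_exp_def)
  moreover have "diff_quot_exp (X x) L $$ (i, j) = (\<Sum>m. diff_quot_pow (X x) L m $$ (i, j) /\<^sub>R fact m)" for x
    using carrier_matD[OF X] ij by (simp add: diff_quot_exp_def)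
  ultimately show ?thesis by simp
qed

end

section \<open>Derivatives of matrix-valued functions, entry by entry\<close>

definition mat_has_deriv :: "nat \<Rightarrow> (real \<Rightarrow> real mat) \<Rightarrow> real mat \<Rightarrow> real \<Rightarrow> real set \<Rightarrow> bool" where
  "mat_has_deriv n X X' x S \<longleftrightarrow> (\<forall>i<n. \<forall>j<n.
     ((\<lambda>s. X s $$ (i, j)) has_real_derivative X' $$ (i, j)) (at x within S))"

lemma mat_has_deriv_mult:
  assumes X: "\<And>s. X s \<in> carrier_mat n n" and Y: "\<And>s. Y s \<in> carrier_mat n n"
    and X': "X' \<in> carrier_mat n n" and Y': "Y' \<in> carrier_mat n n"
    and "mat_has_deriv n X X' x S" "mat_has_deriv n Y Y' x S"
  shows "mat_has_deriv n (\<lambda>s. X s * Y s) (X' * Y x + X x * Y') x S"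
  unfolding mat_has_deriv_def
proof (intro allI impI)
  fix i j assume ij: "i < n" "j < n"
  have "((\<lambda>s. \<Sum>l<n. X s $$ (i, l) * Y s $$ (l, j)) has_real_derivative
      (\<Sum>l<n. X' $$ (i, l) * Y x $$ (l, j) + Y' $$ (l, j) * X x $$ (i, l))) (at x within S)"
    using assms(5,6) ij unfolding mat_has_deriv_def by (intro DERIV_sum DERIV_mult) auto
  moreover have "(\<Sum>l<n. X' $$ (i, l) * Y x $$ (l, j) + Y' $$ (l, j) * X x $$ (i, l))
      = (X' * Y x + X x * Y') $$ (i, j)"
    using carrier_matD[OF mult_carrier_mat[OF X Y']] ij
    by (simp add: index_mult_mat_sum[OF X' Y ij] index_mult_mat_sum[OF X Y' ij] sum.distrib
        mult.commute index_add_mat(1) del: index_mult_mat)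
  ultimately show "((\<lambda>s. (X s * Y s) $$ (i, j)) has_real_derivative (X' * Y x + X x * Y') $$ (i, j))
      (at x within S)"
    unfolding index_mult_mat_sum[OF X Y ij] by simp
qed

text \<open>By commutativity the difference of the exponentials is
  \<open>diff_quot_exp (X s) (X x) * (X s - X x)\<close>. After division by s - x the first factor
  tends to \<open>mat_exp (X x)\<close> and the second to \<open>X'\<close>.\<close>

lemma mat_has_deriv_exp:
  assumes X: "\<And>s. X s \<in> carrier_mat n n" and X': "X' \<in> carrier_mat n n"
    and comm: "\<And>s. X s * X x = X x * X s" and d: "mat_has_deriv n X X' x S"
  shows "mat_has_deriv n (\<lambda>s. mat_exp (X s)) (mat_exp (X x) * X') x S"
  unfolding mat_has_deriv_def has_field_derivative_iff
proof (intro allI impI)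
  fix i j assume ij: "i < n" "j < n"
  let ?F = "at x within S"
  have lim: "((\<lambda>s. X s $$ (i, j)) \<longlongrightarrow> X x $$ (i, j)) ?F" if "i < n" "j < n" for i j
    using d that DERIV_continuous unfolding mat_has_deriv_def continuous_within by blast
  have "((\<lambda>s. \<Sum>l<n. diff_quot_exp (X s) (X x) $$ (i, l) * ((X s $$ (l, j) - X x $$ (l, j)) / (s - x)))
      \<longlongrightarrow> (\<Sum>l<n. mat_exp (X x) $$ (i, l) * X' $$ (l, j))) ?F"
    using d ij unfolding mat_has_deriv_def has_field_derivative_iff
    by (intro tendsto_sum tendsto_mult diff_quot_exp_tendsto lim) (auto simp: X)
  moreover have "(\<Sum>l<n. diff_quot_exp (X s) (X x) $$ (i, l) * ((X s $$ (l, j) - X x $$ (l, j)) / (s - x)))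
      = (mat_exp (X s) $$ (i, j) - mat_exp (X x) $$ (i, j)) / (s - x)" for s
  proof -
    have "(mat_exp (X s) - mat_exp (X x)) $$ (i, j) = (diff_quot_exp (X s) (X x) * (X s - X x)) $$ (i, j)"
      by (simp only: diff_quot_exp_mult[OF X X comm[symmetric]])
    also have "\<dots> = (\<Sum>l<n. diff_quot_exp (X s) (X x) $$ (i, l) * (X s $$ (l, j) - X x $$ (l, j)))"
      using carrier_matD[OF X] ij
      by (subst index_mult_mat_sum[OF diff_quot_exp_carrier[OF X] minus_carrier_mat[OF X] ij]) simp
    finally show ?thesis
      using carrier_matD[OF mat_exp_carrier[OF X]] ij by (simp add: sum_divide_distrib)
  qed
  ultimately show "((\<lambda>s. (mat_exp (X s) $$ (i, j) - mat_exp (X x) $$ (i, j)) / (s - x))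
      \<longlongrightarrow> (mat_exp (X x) * X') $$ (i, j)) ?F"
    unfolding index_mult_mat_sum[OF mat_exp_carrier[OF X] X' ij] by simp
qed

lemma mat_has_deriv_zero_constant:
  assumes X: "\<And>s. X s \<in> carrier_mat n n"
    and d: "\<And>x. x \<in> {0..1} \<Longrightarrow> mat_has_deriv n X (0\<^sub>m n n) x {0..1}" and s: "s \<in> {0..1}"
  shows "X s = X 0"
proof (rule eq_matI)
  fix i j assume "i < dim_row (X 0)" "j < dim_col (X 0)"
  then have ij: "i < n" "j < n" using X[of 0] by auto
  have D: "((\<lambda>s. X s $$ (i, j)) has_real_derivative 0) (at x within {0..1})" if "x \<in> {0..1}" for x
    using d[OF that] ij unfolding mat_has_deriv_def by simp
  have cont: "continuous_on {0..1} (\<lambda>s. X s $$ (i, j))"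
    using D DERIV_continuous unfolding continuous_on_eq_continuous_within by blast
  show "X s $$ (i, j) = X 0 $$ (i, j)"
  proof (cases "s = 0")
    case False
    show ?thesis
    proof (rule DERIV_isconst_end[where f = "\<lambda>s. X s $$ (i, j)"])
      show "0 < s" using False s by simp
      show "continuous_on {0..s} (\<lambda>s. X s $$ (i, j))"
        using cont by (rule continuous_on_subset) (use s in auto)
      show "((\<lambda>s. X s $$ (i, j)) has_real_derivative 0) (at x)" if "0 < x" "x < s" for x
        using D[of x] that s by (simp add: at_within_Icc_at)
    qed
  qed simp
qed (use X[of s] X[of 0] in auto)

lemma pow_zero_mat: "(0\<^sub>m n n :: 'a::comm_ring_1 mat) ^\<^sub>m m = (if m = 0 then 1\<^sub>m n else 0\<^sub>m n n)"
  by (cases m) auto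

lemma mat_exp_zero: "mat_exp (0\<^sub>m n n :: real mat) = 1\<^sub>m n"
proof (rule mat_sums_unique[OF mat_exp_sums[OF zero_carrier_mat]])
  have "(\<lambda>m. (0\<^sub>m n n ^\<^sub>m m) $$ (i, j) /\<^sub>R fact m) sums (1\<^sub>m n $$ (i, j) :: real)"
    if "i < n" "j < n" for i j
  proof -
    have "(\<lambda>m. (0\<^sub>m n n ^\<^sub>m m) $$ (i, j) /\<^sub>R fact m) = (\<lambda>m. if m = 0 then 1\<^sub>m n $$ (i, j) else (0 :: real))"
      by (rule ext) (simp add: pow_zero_mat that)
    then show ?thesis by (simp only: sums_single[of 0 "\<lambda>m. 1\<^sub>m n $$ (i, j)"])
  qed
  then show "mat_sums n (\<lambda>m. 0\<^sub>m n n ^\<^sub>m m) (1\<^sub>m n :: real mat)"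
    by (simp add: mat_sums_def)
qed

lemma mat_exp_commute:
  fixes X Z :: "'a::{real_normed_field, banach} mat"
  assumes "X \<in> carrier_mat n n" "Z \<in> carrier_mat n n" "Z * X = X * Z"
  shows "Z * mat_exp X = mat_exp X * Z"
  by (rule mat_sums_commute[OF mat_exp_sums]) (use assms pow_mat_commute in auto)

lemma uminus_mult_mat:
  fixes P Q :: "'a::ring mat"
  assumes "P \<in> carrier_mat n n" "Q \<in> carrier_mat n n"
  shows "- P * Q = - (P * Q)" "P * - Q = - (P * Q)"
  using assms by simp_all

lemma uminus_zero_mat: "- 0\<^sub>m n n = (0\<^sub>m n n :: 'a::ring mat)"
  by (rule eq_matI) auto

text \<open>Both \<open>e\<^bsup>-X(s)\<^esup> (1 - s B)\<close> and \<open>e\<^bsup>-X(s)\<^esup> e\<^bsup>X(s)\<^esup>\<close> have derivative zero.\<close>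

lemma mat_exp_path:
  fixes X X' :: "real \<Rightarrow> real mat" and B :: "real mat"
  assumes X: "\<And>s. X s \<in> carrier_mat n n" and X': "\<And>s. X' s \<in> carrier_mat n n"
    and B: "B \<in> carrier_mat n n"
    and comm: "\<And>r s. X r * X s = X s * X r" "\<And>r s. X' r * X s = X s * X' r"
    and d: "\<And>s. s \<in> {0..1} \<Longrightarrow> mat_has_deriv n X (X' s) s {0..1}"
    and ode: "\<And>s. s \<in> {0..1} \<Longrightarrow> X' s * (1\<^sub>m n - s \<cdot>\<^sub>m B) = - B"
    and X0: "X 0 = 0\<^sub>m n n" and s: "s \<in> {0..1}"
  shows "mat_exp (X s) = 1\<^sub>m n - s \<cdot>\<^sub>m B"
proof -
  let ?E = "\<lambda>s. mat_exp (- X s)" and ?R = "\<lambda>s. 1\<^sub>m n - s \<cdot>\<^sub>m B"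
  have c: "- X s \<in> carrier_mat n n" "?E s \<in> carrier_mat n n" "?R s \<in> carrier_mat n n"
    "mat_exp (X s) \<in> carrier_mat n n" "- X' s \<in> carrier_mat n n" "- B \<in> carrier_mat n n" for s
    using X X' B by (auto intro!: minus_carrier_mat)
  have dE: "mat_has_deriv n ?E (?E s * - X' s) s {0..1}" if "s \<in> {0..1}" for s
  proof (rule mat_has_deriv_exp[OF c(1) c(5)])
    show "- X r * - X s = - X s * - X r" for r
      unfolding uminus_mult_mat(1)[OF X c(1)] uminus_mult_mat(2)[OF X X] comm(1)[of r s] ..
    show "mat_has_deriv n (\<lambda>s. - X s) (- X' s) s {0..1}"
      using d[OF that] carrier_matD[OF X] carrier_matD[OF X']
      by (auto simp: mat_has_deriv_def intro: DERIV_minus)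
  qed
  have dR: "mat_has_deriv n ?R (- B) s {0..1}" for s
    using B unfolding mat_has_deriv_def by (auto intro!: derivative_eq_intros)
  have R0: "?R 0 = 1\<^sub>m n"
    by (rule eq_matI) (use B in auto)
  have "mat_has_deriv n (\<lambda>s. ?E s * ?R s) (0\<^sub>m n n) s {0..1}" if "s \<in> {0..1}" for s
  proof -
    have "?E s * - X' s * ?R s = ?E s * - (X' s * ?R s)"
      by (simp only: assoc_mult_mat[OF c(2,5,3)] uminus_mult_mat(1)[OF X' c(3)])
    \<comment> \<open>The differential equation turns the first term of the product rule into
      \<open>?E s * B\<close>, which cancels the second.\<close>
    then have "?E s * - X' s * ?R s + ?E s * - B = ?E s * B + - (?E s * B)"
      by (simp only: ode[OF that] uminus_uminus_mat uminus_mult_mat(2)[OF c(2) B])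
    also have "\<dots> = 0\<^sub>m n n"
      by (simp only: add_uminus_minus_mat[OF mult_carrier_mat[OF c(2) B] mult_carrier_mat[OF c(2) B]]
          minus_r_inv_mat[OF mult_carrier_mat[OF c(2) B]])
    finally show ?thesis
      using mat_has_deriv_mult[OF c(2) c(3) mult_carrier_mat[OF c(2) c(5)] c(6) dE[OF that] dR] by simp
  qed
  from mat_has_deriv_zero_constant[OF mult_carrier_mat[OF c(2,3)] this s]
  have ER: "?E s * ?R s = 1\<^sub>m n"
    by (simp add: X0 R0 mat_exp_zero uminus_zero_mat)
  have "mat_has_deriv n (\<lambda>s. ?E s * mat_exp (X s)) (0\<^sub>m n n) s {0..1}" if "s \<in> {0..1}" for s
  proof -
    have "?E s * - X' s * mat_exp (X s) + ?E s * (mat_exp (X s) * X' s)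
        = - (?E s * (mat_exp (X s) * X' s)) + ?E s * (mat_exp (X s) * X' s)"
      by (simp only: assoc_mult_mat[OF c(2,5,4)] uminus_mult_mat(1)[OF X' c(4)]
          uminus_mult_mat(2)[OF c(2) mult_carrier_mat[OF c(4) X']] mat_exp_commute[OF X X' comm(2)])
    also have "\<dots> = 0\<^sub>m n n"
      by (rule uminus_l_inv_mat[OF mult_carrier_mat[OF c(2) mult_carrier_mat[OF c(4) X']]])
    finally show ?thesis
      using mat_has_deriv_mult[OF c(2,4) mult_carrier_mat[OF c(2,5)] mult_carrier_mat[OF c(4) X']
          dE[OF that] mat_has_deriv_exp[OF X X' comm(1) d[OF that]]] by simp
  qed
  from mat_has_deriv_zero_constant[OF mult_carrier_mat[OF c(2,4)] this s]
  have "?E s * mat_exp (X s) = 1\<^sub>m n"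
    by (simp add: X0 mat_exp_zero uminus_zero_mat)
  \<comment> \<open>For square matrices a left inverse is a right inverse. Inserting e^X e^(-X) = 1
    in front of \<open>?R s\<close> and using e^(-X) \<open>?R s\<close> = 1 identifies
    \<open>?R s\<close> with e^X.\<close>
  from mat_mult_left_right_inverse[OF c(2,4) this]
  have "mat_exp (X s) * ?E s = 1\<^sub>m n" .
  then have "?R s = mat_exp (X s) * (?E s * ?R s)"
    using left_mult_one_mat[OF c(3)] by (simp add: assoc_mult_mat[OF c(4,2,3), symmetric])
  then show ?thesis
    unfolding ER using right_mult_one_mat[OF c(4)] by simp
qed

section \<open>Eigenvectors and uniqueness of the principal logarithm\<close>

lemma pow_mat_mult_eigenvector:
  fixes X :: "'a::field mat"
  assumes X: "X \<in> carrier_mat n n" and w: "w \<in> carrier_vec n" and "X *\<^sub>v w = c \<cdot>\<^sub>v w"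
  shows "X ^\<^sub>m m *\<^sub>v w = c ^ m \<cdot>\<^sub>v w"
proof (induction m)
  case (Suc m)
  have "X ^\<^sub>m Suc m *\<^sub>v w = c \<cdot>\<^sub>v (X ^\<^sub>m m *\<^sub>v w)"
    using assms by (simp add: assoc_mult_mat_vec[OF pow_carrier_mat[OF X] X w]
        mult_mat_vec[OF pow_carrier_mat[OF X] w])
  then show ?case by (simp add: Suc smult_smult_assoc)
qed (use X w in simp)

lemma mat_exp_mult_eigenvector:
  fixes X :: "complex mat"
  assumes X: "X \<in> carrier_mat n n" and w: "w \<in> carrier_vec n" and ev: "X *\<^sub>v w = c \<cdot>\<^sub>v w"
  shows "mat_exp X *\<^sub>v w = exp c \<cdot>\<^sub>v w"
proof (rule eq_vecI)
  fix i assume "i < dim_vec (exp c \<cdot>\<^sub>v w)"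
  then have i: "i < n" using w by simp
  have "(\<lambda>m. (c ^ m /\<^sub>R fact m) * w $ i) sums (exp c * w $ i)"
    by (intro sums_mult2 exp_converges)
  moreover have "(\<lambda>m. (c ^ m /\<^sub>R fact m) * w $ i) sums (mat_exp X *\<^sub>v w) $ i"
    using mat_sums_mult_vec[OF mat_exp_sums[OF X] w i] w i
    by (simp add: pow_mat_mult_eigenvector[OF X w ev])
  ultimately show "(mat_exp X *\<^sub>v w) $ i = (exp c \<cdot>\<^sub>v w) $ i"
    using w i by (auto dest: sums_unique2)
qed (use w mat_exp_carrier[OF X] in auto)

text \<open>On a common eigenvector with one common eigenvalue c, the m-th divided difference acts
  as the scalar m c^(m-1), and the weighted sum of these scalars is e^c.\<close>

lemma diff_quot_exp_mult_eigenvector: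
  fixes X Y :: "complex mat"
  assumes X: "X \<in> carrier_mat n n" and Y: "Y \<in> carrier_mat n n" and w: "w \<in> carrier_vec n"
    and Xw: "X *\<^sub>v w = c \<cdot>\<^sub>v w" and Yw: "Y *\<^sub>v w = c \<cdot>\<^sub>v w"
  shows "diff_quot_exp X Y *\<^sub>v w = exp c \<cdot>\<^sub>v w"
proof (rule eq_vecI)
  fix i assume "i < dim_vec (exp c \<cdot>\<^sub>v w)"
  then have i: "i < n" using w by simp
  let ?S = "diff_quot_pow X Y"
  have rec: "(?S (Suc m) *\<^sub>v w) $ i = c ^ m * w $ i + c * (?S m *\<^sub>v w) $ i" for m
  proof -
    have "?S (Suc m) *\<^sub>v w = c ^ m \<cdot>\<^sub>v w + c \<cdot>\<^sub>v (?S m *\<^sub>v w)"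
      using diff_quot_pow_carrier[OF X Y, of m] X Y w
      by (simp add: add_mult_distrib_mat_vec[OF pow_carrier_mat[OF X] mult_carrier_mat[OF diff_quot_pow_carrier[OF X Y] Y] w]
          assoc_mult_mat_vec[OF diff_quot_pow_carrier[OF X Y] Y w] Yw
          mult_mat_vec[OF diff_quot_pow_carrier[OF X Y] w] pow_mat_mult_eigenvector[OF X w Xw])
    then show ?thesis using w i carrier_matD[OF diff_quot_pow_carrier[OF X Y]] by simp
  qed
  have S: "(?S (Suc m) *\<^sub>v w) $ i = real (Suc m) *\<^sub>R (c ^ m * w $ i)" for m
  proof (induction m)
    case 0
    then show ?case using X w i unfolding rec by simp
  next
    case (Suc m)
    then show ?case unfolding rec[of "Suc m"] by (simp add: scaleR_conv_of_real algebra_simps)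
  qed
  have "(\<lambda>m. (?S m *\<^sub>v w) $ i /\<^sub>R fact m) sums (exp c * w $ i)"
  proof (rule sums_shift_fact[where a = "\<lambda>m. c ^ m * w $ i"])
    show "(?S 0 *\<^sub>v w) $ i = 0" using X w i by simp
    show "(\<lambda>m. (c ^ m * w $ i) /\<^sub>R fact m) sums (exp c * w $ i)"
      using sums_mult2[OF exp_converges[of c], of "w $ i"] by simp
  qed (rule S)
  with mat_sums_mult_vec[OF diff_quot_exp_sums[OF X Y] w i]
  show "(diff_quot_exp X Y *\<^sub>v w) $ i = (exp c \<cdot>\<^sub>v w) $ i"
    using w i by (auto dest: sums_unique2)
qed (use w diff_quot_exp_carrier[OF X] in auto)

lemma smult_vec_cancel:
  fixes w :: "'a::field vec"
  assumes "w \<in> carrier_vec n" "w \<noteq> 0\<^sub>v n" "a \<cdot>\<^sub>v w = b \<cdot>\<^sub>v w"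
  shows "a = b"
proof -
  obtain i where "i < n" "w $ i \<noteq> 0"
    using assms(1,2) by (auto simp: vec_eq_iff)
  with assms show ?thesis
    by (metis carrier_vecD index_smult_vec(1) mult_right_cancel)
qed

text \<open>Inside the strip Im z is the principal argument of e^z, and Re z is determined by the
  norm of e^z.\<close>

lemma exp_eq_strip:
  assumes "exp a = exp b" "- pi < Im a" "Im a < pi" "- pi < Im b" "Im b < pi"
  shows "a = b"
proof -
  have "sgn (exp z) = cis (Im z)" for z
    by (simp add: exp_eq_polar sgn_mult sgn_of_real)
  then have "Im a = Im b"
    using cis_Arg_unique assms by (metis less_imp_le)
  moreover have "Re a = Re b"
    using arg_cong[OF assms(1), of norm] by simp
  ultimately show ?thesis by (simp add: complex_eq_iff)
qed

lemma spectrumI: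
  "X \<in> carrier_mat n n \<Longrightarrow> w \<in> carrier_vec n \<Longrightarrow> w \<noteq> 0\<^sub>v n \<Longrightarrow> X *\<^sub>v w = c \<cdot>\<^sub>v w \<Longrightarrow> c \<in> spectrum X"
  by (auto simp: spectrum_def eigenvalue_def eigenvector_def)

lemma spectrumE:
  assumes "c \<in> spectrum X" "X \<in> carrier_mat n n"
  obtains w where "w \<in> carrier_vec n" "w \<noteq> 0\<^sub>v n" "X *\<^sub>v w = c \<cdot>\<^sub>v w"
  using assms by (auto simp: spectrum_def eigenvalue_def eigenvector_def)

text \<open>If \<open>X \<noteq> Y\<close>, the kernel of the divided difference of \<open>exp\<close> contains a common eigenvector of
  \<open>X\<close> and \<open>Y\<close>. Injectivity of \<open>exp\<close> on the strip makes the two eigenvalues equal, so the divided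
  difference acts on this vector as multiplication by a nonzero number.\<close>

lemma mat_exp_eq_imp_eq:
  fixes X Y :: "complex mat"
  assumes X: "X \<in> carrier_mat n n" and Y: "Y \<in> carrier_mat n n" and XY: "Y * X = X * Y"
    and eq: "mat_exp X = mat_exp Y"
    and strip: "\<And>z. z \<in> spectrum X \<union> spectrum Y \<Longrightarrow> - pi < Im z \<and> Im z < pi"
  shows "X = Y"
proof (rule ccontr)
  assume "X \<noteq> Y"
  let ?G = "diff_quot_exp X Y"
  have G: "?G \<in> carrier_mat n n" using X by simp
  have D: "X - Y \<in> carrier_mat n n" using Y by (rule minus_carrier_mat)
  have GD: "?G * (X - Y) = 0\<^sub>m n n"
    unfolding diff_quot_exp_mult[OF X Y XY] eq by (rule minus_r_inv_mat) (use Y in simp)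
  from \<open>X \<noteq> Y\<close> obtain i j where ij: "i < n" "j < n" "X $$ (i, j) \<noteq> Y $$ (i, j)"
    using X Y by (auto simp: mat_eq_iff)
  \<comment> \<open>A nonzero column of \<open>X - Y\<close> is the first kernel vector of
    \<open>?G\<close>, because \<open>?G * (X - Y)\<close> vanishes.\<close>
  let ?z = "col (X - Y) j"
  have z: "?z \<in> carrier_vec n" using D ij by simp
  have "?z $ i \<noteq> 0" using X Y ij by simp
  then have "?z \<noteq> 0\<^sub>v n" using ij by auto
  have "?G *\<^sub>v ?z = col (?G * (X - Y)) j"
    using col_mult2[OF G D ij(2)] by simp
  also have "\<dots> = 0\<^sub>v n" using ij by (simp add: GD)
  finally have Gz: "?G *\<^sub>v ?z = 0\<^sub>v n" .
  define K where "K = {w \<in> carrier_vec n. ?G *\<^sub>v w = 0\<^sub>v n}"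
  have K: "K \<subseteq> carrier_vec n" by (auto simp: K_def)
  \<comment> \<open>The matrix Z stands for X when the first eigenvector is sought, and for Y when
    the second is.\<close>
  have K_inv: "Z *\<^sub>v w \<in> K"
    if Z: "Z \<in> carrier_mat n n" "Z * X = X * Z" "Z * Y = Y * Z" and w: "w \<in> K" for Z w
  proof -
    have w': "w \<in> carrier_vec n" using w by (simp add: K_def)
    have "Z * ?G = ?G * Z"
      by (rule mat_sums_commute[OF diff_quot_exp_sums[OF X Y] Z(1)])
        (rule diff_quot_pow_commute[OF X Y Z])
    then have "?G *\<^sub>v (Z *\<^sub>v w) = Z *\<^sub>v (?G *\<^sub>v w)"
      using assoc_mult_mat_vec[OF G Z(1) w'] assoc_mult_mat_vec[OF Z(1) G w'] by metis
    then show ?thesis using w Z(1) by (simp add: K_def mult_mat_vec_zero)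
  qed
  have K_add: "u + w \<in> K" if "u \<in> K" "w \<in> K" for u w
    using that by (auto simp: K_def mult_add_distrib_mat_vec[OF G])
  have K_smult: "a \<cdot>\<^sub>v w \<in> K" if "w \<in> K" for a w
    using that by (auto simp: K_def mult_mat_vec[OF G] smult_vec_zero)
  have K_0: "0\<^sub>v n \<in> K" using G by (simp add: K_def mult_mat_vec_zero)
  have zK: "?z \<in> K" using z Gz by (simp add: K_def)
  obtain w1 c where w1: "w1 \<in> K" "w1 \<noteq> 0\<^sub>v n" "X *\<^sub>v w1 = c \<cdot>\<^sub>v w1"
    by (rule invariant_subspace_eigenvector[OF X K zK \<open>?z \<noteq> 0\<^sub>v n\<close> K_0
          K_inv[OF X refl XY[symmetric]] K_smult K_add])
  \<comment> \<open>The eigenspace of X inside the kernel is preserved by Y, so an eigenvector of Y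
    found in it is also one of X.\<close>
  define K' where "K' = {w \<in> K. X *\<^sub>v w = c \<cdot>\<^sub>v w}"
  have K': "K' \<subseteq> carrier_vec n" using K by (auto simp: K'_def)
  have K'_0: "0\<^sub>v n \<in> K'" using K_0 by (simp add: K'_def mult_mat_vec_zero[OF X] smult_vec_zero)
  have K'_inv: "Y *\<^sub>v w \<in> K'" if w: "w \<in> K'" for w
  proof -
    have w': "w \<in> carrier_vec n" and "w \<in> K" "X *\<^sub>v w = c \<cdot>\<^sub>v w"
      using w K' by (auto simp: K'_def)
    have "X *\<^sub>v (Y *\<^sub>v w) = Y *\<^sub>v (X *\<^sub>v w)"
      using assoc_mult_mat_vec[OF X Y w'] assoc_mult_mat_vec[OF Y X w'] XY by metis
    then show ?thesis
      using \<open>X *\<^sub>v w = c \<cdot>\<^sub>v w\<close> K_inv[OF Y XY refl \<open>w \<in> K\<close>]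
      by (simp add: K'_def mult_mat_vec[OF Y w'])
  qed
  have K'_smult: "a \<cdot>\<^sub>v w \<in> K'" if "w \<in> K'" for a w
  proof -
    have "w \<in> carrier_vec n" "X *\<^sub>v w = c \<cdot>\<^sub>v w" using that K' by (auto simp: K'_def)
    then have "X *\<^sub>v (a \<cdot>\<^sub>v w) = c \<cdot>\<^sub>v (a \<cdot>\<^sub>v w)"
      by (simp add: mult_mat_vec[OF X] smult_smult_assoc mult.commute)
    then show ?thesis using that K_smult by (simp add: K'_def)
  qed
  have K'_add: "u + w \<in> K'" if "u \<in> K'" "w \<in> K'" for u w
  proof -
    have "u \<in> carrier_vec n" "w \<in> carrier_vec n" "X *\<^sub>v u = c \<cdot>\<^sub>v u" "X *\<^sub>v w = c \<cdot>\<^sub>v w"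
      using that K' by (auto simp: K'_def)
    then have "X *\<^sub>v (u + w) = c \<cdot>\<^sub>v (u + w)"
      by (simp add: mult_add_distrib_mat_vec[OF X] smult_add_distrib_vec[of _ n])
    then show ?thesis using that K_add by (simp add: K'_def)
  qed
  have w1K': "w1 \<in> K'" using w1 by (simp add: K'_def)
  obtain w d where w: "w \<in> K'" "w \<noteq> 0\<^sub>v n" "Y *\<^sub>v w = d \<cdot>\<^sub>v w"
    by (rule invariant_subspace_eigenvector[OF Y K' w1K' w1(2) K'_0 K'_inv K'_smult K'_add])
  have w': "w \<in> carrier_vec n" "X *\<^sub>v w = c \<cdot>\<^sub>v w" "?G *\<^sub>v w = 0\<^sub>v n"
    using w(1) by (auto simp: K'_def K_def)
  have "exp c \<cdot>\<^sub>v w = exp d \<cdot>\<^sub>v w"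
    using mat_exp_mult_eigenvector[OF X w'(1,2)] mat_exp_mult_eigenvector[OF Y w'(1) w(3)] eq by simp
  then have "exp c = exp d" by (rule smult_vec_cancel[OF w'(1) w(2)])
  moreover have "- pi < Im c \<and> Im c < pi"
    by (rule strip) (rule UnI1[OF spectrumI[OF X w'(1) w(2) w'(2)]])
  moreover have "- pi < Im d \<and> Im d < pi"
    by (rule strip) (rule UnI2[OF spectrumI[OF Y w'(1) w(2,3)]])
  ultimately have "c = d"
    using exp_eq_strip by blast
  then have "exp c \<cdot>\<^sub>v w = 0\<^sub>v n"
    using diff_quot_exp_mult_eigenvector[OF X Y w'(1,2)] w(3) w'(3) by simp
  then have "exp c \<cdot>\<^sub>v w = 0 \<cdot>\<^sub>v w"
    using w'(1) by (simp add: smult_zero_vec)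
  from smult_vec_cancel[OF w'(1) w(2) this] show False by simp
qed

text \<open>Uniqueness of the logarithm is argued over the complex numbers, where eigenvectors
  exist; this transfers the equality of real exponentials there.\<close>

lemma map_mat_mat_exp:
  assumes X: "X \<in> carrier_mat n n"
  shows "map_mat complex_of_real (mat_exp X) = mat_exp (map_mat complex_of_real X)"
proof (rule mat_sums_unique)
  have "map_mat complex_of_real X ^\<^sub>m m = map_mat complex_of_real (X ^\<^sub>m m)" for m
    by (rule of_real_hom.mat_hom_pow[OF X, symmetric])
  moreover have "(\<lambda>m. complex_of_real ((X ^\<^sub>m m) $$ (i, j)) /\<^sub>R fact m) sums of_real (mat_exp X $$ (i, j))"
    if "i < n" "j < n" for i j
    using sums_of_real[where 'a = complex, of "\<lambda>m. (X ^\<^sub>m m) $$ (i, j) /\<^sub>R fact m"] mat_exp_sums[OF X] that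
    by (simp add: mat_sums_def scaleR_conv_of_real)
  ultimately show "mat_sums n (\<lambda>m. map_mat complex_of_real X ^\<^sub>m m) (map_mat complex_of_real (mat_exp X))"
    using X carrier_matD[OF mat_exp_carrier[OF X]] carrier_matD[OF pow_carrier_mat[OF X]]
    by (simp add: mat_sums_def)
  show "mat_sums n (\<lambda>m. map_mat complex_of_real X ^\<^sub>m m) (mat_exp (map_mat complex_of_real X))"
    using X by (intro mat_exp_sums) simp
qed

section \<open>Polynomials in a matrix and the companion system\<close>

text \<open>Closure and the entry formula share one induction, because reading an entry of the sum
  in the insert step requires the dimensions of the partial sum.\<close>

lemma mat_power_sum_closed_index:
  fixes A :: "'a::comm_ring_1 mat"
  assumes A: "A \<in> carrier_mat n n" and "finite I"
  shows "mat_power_sum n I a A \<in> carrier_mat n n \<and>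
    (\<forall>i<n. \<forall>j<n. mat_power_sum n I a A $$ (i, j) = (\<Sum>l\<in>I. a l * (A ^\<^sub>m l) $$ (i, j)))"
  using assms(2)
proof (induction I rule: finite_induct)
  case empty
  interpret abelian_group "module_mat TYPE('a) n n" by (rule abelian_group_mat)
  show ?case by (simp add: mat_power_sum_def module_mat_simps)
next
  case (insert l I)
  interpret abelian_group "module_mat TYPE('a) n n" by (rule abelian_group_mat)
  have c: "(\<lambda>l. a l \<cdot>\<^sub>m A ^\<^sub>m l) \<in> J \<rightarrow> carrier (module_mat TYPE('a) n n)" for J
    using A by (simp add: module_mat_simps)
  have "mat_power_sum n (insert l I) a A = a l \<cdot>\<^sub>m A ^\<^sub>m l + mat_power_sum n I a A"
    unfolding mat_power_sum_def
    by (subst finsum_insert[OF insert.hyps c]) (use A in \<open>auto simp: module_mat_simps\<close>)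
  then show ?case
    using insert A carrier_matD[OF conjunct1[OF insert.IH]] by simp
qed

lemma mat_power_sum_carrier:
  "A \<in> carrier_mat n n \<Longrightarrow> finite I \<Longrightarrow> mat_power_sum n I a A \<in> carrier_mat n n"
  using mat_power_sum_closed_index by blast

lemma index_mat_power_sum:
  "A \<in> carrier_mat n n \<Longrightarrow> finite I \<Longrightarrow> i < n \<Longrightarrow> j < n \<Longrightarrow>
    mat_power_sum n I a A $$ (i, j) = (\<Sum>l\<in>I. a l * (A ^\<^sub>m l) $$ (i, j))"
  using mat_power_sum_closed_index by blast

lemma mat_power_sum_mult:
  fixes A Z :: "'a::comm_ring_1 mat"
  assumes A: "A \<in> carrier_mat n n" and I: "finite I" and Z: "Z \<in> carrier_mat n n" and ij: "i < n" "j < n"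
  shows "(mat_power_sum n I a A * Z) $$ (i, j) = (\<Sum>l\<in>I. a l * (A ^\<^sub>m l * Z) $$ (i, j))"
    and "(Z * mat_power_sum n I a A) $$ (i, j) = (\<Sum>l\<in>I. a l * (Z * A ^\<^sub>m l) $$ (i, j))"
proof -
  note c = mat_power_sum_carrier[OF A I]
  have "(\<Sum>m<n. (\<Sum>l\<in>I. a l * (A ^\<^sub>m l) $$ (i, m)) * Z $$ (m, j))
      = (\<Sum>l\<in>I. a l * (\<Sum>m<n. (A ^\<^sub>m l) $$ (i, m) * Z $$ (m, j)))"
    unfolding sum_distrib_left sum_distrib_right by (subst sum.swap) (simp add: ac_simps)
  then show "(mat_power_sum n I a A * Z) $$ (i, j) = (\<Sum>l\<in>I. a l * (A ^\<^sub>m l * Z) $$ (i, j))"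
    using ij by (simp add: index_mult_mat_sum[OF c Z ij] index_mat_power_sum[OF A I]
        index_mult_mat_sum[OF pow_carrier_mat[OF A] Z ij] del: index_mult_mat)
  have "(\<Sum>m<n. Z $$ (i, m) * (\<Sum>l\<in>I. a l * (A ^\<^sub>m l) $$ (m, j)))
      = (\<Sum>l\<in>I. a l * (\<Sum>m<n. Z $$ (i, m) * (A ^\<^sub>m l) $$ (m, j)))"
    unfolding sum_distrib_left by (subst sum.swap) (simp add: ac_simps)
  then show "(Z * mat_power_sum n I a A) $$ (i, j) = (\<Sum>l\<in>I. a l * (Z * A ^\<^sub>m l) $$ (i, j))"
    using ij by (simp add: index_mult_mat_sum[OF Z c ij] index_mat_power_sum[OF A I]
        index_mult_mat_sum[OF Z pow_carrier_mat[OF A] ij] del: index_mult_mat)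
qed

lemma mat_power_sum_commute:
  fixes A Z :: "'a::comm_ring_1 mat"
  assumes A: "A \<in> carrier_mat n n" and I: "finite I" and Z: "Z \<in> carrier_mat n n" and "Z * A = A * Z"
  shows "Z * mat_power_sum n I a A = mat_power_sum n I a A * Z"
proof -
  have c: "mat_power_sum n I a A * Z \<in> carrier_mat n n" "Z * mat_power_sum n I a A \<in> carrier_mat n n"
    using mat_power_sum_carrier[OF A I] Z by (auto intro!: mult_carrier_mat)
  show ?thesis
    by (rule eq_matI)
      (use c[THEN carrier_matD(1)] c[THEN carrier_matD(2)] in
        \<open>simp_all add: mat_power_sum_mult[OF A I Z] pow_mat_commute[OF A Z assms(4)] del: index_mult_mat\<close>)
qed

lemma mat_power_sum_mult_eigenvector:
  fixes A :: "'a::field mat"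
  assumes A: "A \<in> carrier_mat n n" and I: "finite I" and w: "w \<in> carrier_vec n"
    and ev: "A *\<^sub>v w = c \<cdot>\<^sub>v w"
  shows "mat_power_sum n I a A *\<^sub>v w = (\<Sum>l\<in>I. a l * c ^ l) \<cdot>\<^sub>v w"
proof (rule eq_vecI)
  fix i assume "i < dim_vec ((\<Sum>l\<in>I. a l * c ^ l) \<cdot>\<^sub>v w)"
  then have i: "i < n" using w by simp
  have "(\<Sum>m<n. (A ^\<^sub>m l) $$ (i, m) * w $ m) = c ^ l * w $ i" for l
    using pow_mat_mult_eigenvector[OF A w ev, of l] w i
    by (simp flip: index_mult_mat_vec_sum[OF pow_carrier_mat[OF A] w i] del: index_mult_mat_vec)
  then have "(\<Sum>m<n. (\<Sum>l\<in>I. a l * (A ^\<^sub>m l) $$ (i, m)) * w $ m) = (\<Sum>l\<in>I. a l * (c ^ l * w $ i))"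
    unfolding sum_distrib_right by (subst sum.swap) (simp add: mult.assoc flip: sum_distrib_left)
  then show "(mat_power_sum n I a A *\<^sub>v w) $ i = ((\<Sum>l\<in>I. a l * c ^ l) \<cdot>\<^sub>v w) $ i"
    using w i by (simp add: index_mult_mat_vec_sum[OF mat_power_sum_carrier[OF A I] w i]
        index_mat_power_sum[OF A I] sum_distrib_right mult.assoc del: index_mult_mat_vec)
qed (use w mat_power_sum_carrier[OF A I] in auto)

lemma map_mat_mat_power_sum:
  fixes A :: "real mat"
  assumes A: "A \<in> carrier_mat n n" and I: "finite I"
  shows "map_mat complex_of_real (mat_power_sum n I a A)
    = mat_power_sum n I (\<lambda>l. of_real (a l)) (map_mat of_real A)"
proof -
  have A': "map_mat complex_of_real A \<in> carrier_mat n n" using A by simp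
  have p: "map_mat complex_of_real A ^\<^sub>m l = map_mat complex_of_real (A ^\<^sub>m l)" for l
    by (rule of_real_hom.mat_hom_pow[OF A, symmetric])
  show ?thesis
    by (rule eq_matI)
      (use carrier_matD[OF mat_power_sum_carrier[OF A I]] carrier_matD[OF mat_power_sum_carrier[OF A' I]]
          carrier_matD[OF pow_carrier_mat[OF A]] in
        \<open>simp_all add: index_mat_power_sum[OF A I] index_mat_power_sum[OF A' I] p\<close>)
qed

text \<open>For monic \<open>p\<close> the companion matrix is multiplication by the variable modulo
  \<open>p\<close> on coefficient vectors: coefficients shift up by one, and the overflow
  \<open>v $ m\<close> is reduced by \<open>p\<close>.\<close>

lemma companion_mat_mult_vec:
  fixes p :: "'a::comm_ring_1 poly"
  assumes p: "degree p = Suc m" and v: "v \<in> carrier_vec (Suc m)" and r: "r < Suc m"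
  shows "(companion_mat p *\<^sub>v v) $ r = (if r = 0 then 0 else v $ (r - 1)) - coeff p r * v $ m"
proof -
  have C: "companion_mat p \<in> carrier_mat (Suc m) (Suc m)" using p by (simp add: companion_mat_def)
  have "(companion_mat p *\<^sub>v v) $ r
      = (\<Sum>j<m. (if r = j + 1 then 1 else 0) * v $ j) + - coeff p r * v $ m"
    unfolding index_mult_mat_vec_sum[OF C v r] using p r by (simp add: companion_mat_def)
  also have "(\<Sum>j<m. (if r = j + 1 then 1 else 0) * v $ j) = (\<Sum>j<m. if j = r - 1 \<and> r \<noteq> 0 then v $ j else 0)"
    by (rule sum.cong) auto
  also have "\<dots> = (if r = 0 then 0 else v $ (r - 1))"
    using r by (cases r) simp_all
  finally show ?thesis by simp
qed

text \<open>Multiplying row \<open>r\<close> of the companion system by \<open>A\<^sup>r\<close> and adding up turns the companion matrix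
  into multiplication by \<open>A\<close>, because \<open>p(A) = 0\<close> expresses \<open>A\<^sup>k\<close> by the lower powers.\<close>

lemma companion_system:
  fixes A :: "'a::comm_ring_1 mat"
  assumes A: "A \<in> carrier_mat n n" and k: "k \<ge> 2" and p: "monic p" "degree p = k" "poly_mat p A = 0\<^sub>m n n"
    and v: "v \<in> carrier_vec k" and eq: "(1\<^sub>m k - u \<cdot>\<^sub>m companion_mat p) *\<^sub>v v = - unit_vec k 1"
  defines "V \<equiv> mat_power_sum n {..<k} (\<lambda>l. v $ l) A"
  shows "V * (1\<^sub>m n - u \<cdot>\<^sub>m A) = - A"
proof -
  obtain m where m: "k = Suc m" "m \<ge> 1" using k by (cases k) auto
  have V: "V \<in> carrier_mat n n" unfolding V_def by (rule mat_power_sum_carrier[OF A]) simp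
  have C: "companion_mat p \<in> carrier_mat k k" using p by (simp add: companion_mat_def)
  have row: "v $ r - u * ((if r = 0 then 0 else v $ (r - 1)) - coeff p r * v $ m)
      = (if r = 1 then - 1 else 0)" if r: "r < k" for r
  proof -
    have "(1\<^sub>m k - u \<cdot>\<^sub>m companion_mat p) *\<^sub>v v = v - u \<cdot>\<^sub>v (companion_mat p *\<^sub>v v)"
      using minus_mult_distrib_mat_vec[OF one_carrier_mat smult_carrier_mat[OF C] v] v C
      by (intro eq_vecI) auto
    then have "(v - u \<cdot>\<^sub>v (companion_mat p *\<^sub>v v)) $ r = (- unit_vec k 1) $ r"
      using eq by simp
    then show ?thesis
      using r v C companion_mat_mult_vec[of p m v r] p m
      by (simp add: unit_vec_def del: index_mult_mat_vec split: if_splits)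
  qed
  have "V $$ (i, j) - u * (V * A) $$ (i, j) = - A $$ (i, j)" if ij: "i < n" "j < n" for i j
  proof -
    define P where "P l = (A ^\<^sub>m l) $$ (i, j)" for l
    have "(\<Sum>l\<le>k. coeff p l * P l) = 0"
      using p(3) A ij index_mat_power_sum[OF A _ ij, of "{..k}" "coeff p"]
      unfolding poly_mat_def p(2) P_def by simp
    \<comment> \<open>Monicity isolates the top power. This relation will supply the term
      \<open>v $ m * P k\<close> of \<open>V * A\<close>, the one that the shifted sum over r < m
      lacks.\<close>
    then have Pk: "(\<Sum>l<k. coeff p l * P l) = - P k"
      using p(1,2) by (simp add: lessThan_Suc_atMost[symmetric] add_eq_0_iff)
    have P1: "P 1 = A $$ (i, j)" using A by (simp add: P_def)
    have VA: "(V * A) $$ (i, j) = (\<Sum>l<k. v $ l * P (Suc l))"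
      unfolding V_def P_def using mat_power_sum_mult(1)[OF A _ A ij, of "{..<k}"] by simp
    have split: "(\<Sum>r<k. v $ r * P (Suc r)) = (\<Sum>r<m. v $ r * P (Suc r)) + v $ m * P k"
      unfolding m(1) by simp
    \<comment> \<open>Row r gets the weight \<open>P r\<close>. With indices from 0, e_2 sits at
      index 1, which is below k since k >= 2, and the weight there is the entry of A itself.\<close>
    have "- P 1 = (\<Sum>r<k. (if r = 1 then - 1 else 0) * P r)"
      using k by (simp add: if_distrib[of "\<lambda>x. x * _"] sum.delta cong: if_cong)
    also have "\<dots> = (\<Sum>r<k. (v $ r - u * ((if r = 0 then 0 else v $ (r - 1)) - coeff p r * v $ m)) * P r)"
      by (rule sum.cong) (simp_all add: row)
    also have "\<dots> = (\<Sum>r<k. v $ r * P r) - u * (\<Sum>r<k. (if r = 0 then 0 else v $ (r - 1)) * P r)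
        + u * v $ m * (\<Sum>r<k. coeff p r * P r)"
      unfolding sum_distrib_left sum_subtractf[symmetric] sum.distrib[symmetric]
      by (rule sum.cong[OF refl]) (simp only: ring_distribs mult.assoc
          mult.left_commute[of "coeff p _" "v $ m"] diff_diff_eq2 diff_add_eq)
    also have "(\<Sum>r<k. (if r = 0 then 0 else v $ (r - 1)) * P r) = (\<Sum>r<m. v $ r * P (Suc r))"
      unfolding m(1) by (simp add: sum.lessThan_Suc_shift del: sum.lessThan_Suc)
    finally have "- P 1 = (\<Sum>r<k. v $ r * P r) - u * (\<Sum>r<k. v $ r * P (Suc r))"
      unfolding Pk split by (simp add: algebra_simps)
    then show ?thesis
      unfolding VA P1 by (simp add: V_def P_def index_mat_power_sum[OF A _ ij])
  qed
  then have "V - u \<cdot>\<^sub>m (V * A) = - A"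
    using V A carrier_matD[OF mult_carrier_mat[OF V A]] by (intro eq_matI) (auto simp del: index_mult_mat(1))
  moreover have "V * (1\<^sub>m n - u \<cdot>\<^sub>m A) = V - u \<cdot>\<^sub>m (V * A)"
    using mult_minus_distrib_mat[OF V one_carrier_mat smult_carrier_mat[OF A, of u]] V
    by (simp add: mult_smult_distrib[OF V A])
  ultimately show ?thesis by simp
qed

section \<open>The principal logarithm\<close>

lemma one_minus_smult_mult_vec_iff:
  fixes A :: "'a::field mat"
  assumes A: "A \<in> carrier_mat n n" and w: "w \<in> carrier_vec n"
  shows "(1\<^sub>m n - t \<cdot>\<^sub>m A) *\<^sub>v w = z \<cdot>\<^sub>v w \<longleftrightarrow> t \<cdot>\<^sub>v (A *\<^sub>v w) = (1 - z) \<cdot>\<^sub>v w"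
proof -
  have "(1\<^sub>m n - t \<cdot>\<^sub>m A) *\<^sub>v w = w - t \<cdot>\<^sub>v (A *\<^sub>v w)"
    using minus_mult_distrib_mat_vec[OF one_carrier_mat smult_carrier_mat[OF A, of t] w] w A
    by (intro eq_vecI) auto
  then show ?thesis
    using A w by (simp only:) (auto simp: vec_eq_iff algebra_simps)
qed

section \<open>Eigenvalues and the domain of the logarithm\<close>

lemma map_mat_one_minus_smult:
  assumes "A \<in> carrier_mat n n"
  shows "map_mat complex_of_real (1\<^sub>m n - t \<cdot>\<^sub>m A) = 1\<^sub>m n - of_real t \<cdot>\<^sub>m map_mat of_real A"
  using assms by (intro eq_matI) auto

text \<open>An eigenvalue z of I - tA is expressed as the eigenvalue 1 - z of tA, a form that
  rescales easily in t.\<close>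

lemma log_domain_eigenvalue:
  assumes A: "A \<in> carrier_mat n n" and w: "w \<in> carrier_vec n" "w \<noteq> 0\<^sub>v n"
    and t: "t \<in> log_domain A" and ev: "of_real t \<cdot>\<^sub>v (map_mat complex_of_real A *\<^sub>v w) = (1 - z) \<cdot>\<^sub>v w"
  shows "z \<notin> \<real>\<^sub>\<le>\<^sub>0"
proof -
  have A': "map_mat complex_of_real A \<in> carrier_mat n n" using A by simp
  have B: "map_mat complex_of_real (1\<^sub>m n - t \<cdot>\<^sub>m A) \<in> carrier_mat n n"
    using A by (simp add: minus_carrier_mat)
  have "map_mat complex_of_real (1\<^sub>m n - t \<cdot>\<^sub>m A) *\<^sub>v w = z \<cdot>\<^sub>v w"
    using ev by (simp only: map_mat_one_minus_smult[OF A] one_minus_smult_mult_vec_iff[OF A' w(1)])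
  from spectrumI[OF B w this] show ?thesis
    using t A by (auto simp: log_domain_def)
qed

text \<open>Let x <= 0 be an eigenvalue of I - stA. Then s is nonzero, as s = 0 would give x = 1.
  Dividing by s shows that tA has the eigenvalue (1 - x)/s >= 1, so I - tA has an eigenvalue in the
  forbidden half-line.\<close>

lemma log_domain_star_shaped:
  assumes A: "A \<in> carrier_mat n n" and t: "t \<in> log_domain A" and s: "s \<in> {0..1}"
  shows "s * t \<in> log_domain A"
proof (rule ccontr)
  assume "s * t \<notin> log_domain A"
  then obtain z where z: "z \<in> complex_spectrum (1\<^sub>m n - (s * t) \<cdot>\<^sub>m A)" "z \<in> \<real>\<^sub>\<le>\<^sub>0"
    using A by (auto simp: log_domain_def)
  have A': "map_mat complex_of_real A \<in> carrier_mat n n" using A by simp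
  have B: "map_mat complex_of_real (1\<^sub>m n - (s * t) \<cdot>\<^sub>m A) \<in> carrier_mat n n"
    using A by (simp add: minus_carrier_mat)
  from z(1) B obtain w where w: "w \<in> carrier_vec n" "w \<noteq> 0\<^sub>v n"
    "map_mat complex_of_real (1\<^sub>m n - (s * t) \<cdot>\<^sub>m A) *\<^sub>v w = z \<cdot>\<^sub>v w"
    by (rule spectrumE)
  have ev: "of_real (s * t) \<cdot>\<^sub>v (map_mat complex_of_real A *\<^sub>v w) = (1 - z) \<cdot>\<^sub>v w"
    using w(3) by (simp only: map_mat_one_minus_smult[OF A] one_minus_smult_mult_vec_iff[OF A' w(1)])
  obtain x where x: "z = complex_of_real x" "x \<le> 0"
    using z(2) by (auto elim: nonpos_Reals_cases)
  have "s \<noteq> 0"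
  proof
    assume "s = 0"
    then have "0 \<cdot>\<^sub>v w = (1 - z) \<cdot>\<^sub>v w"
      using ev w(1) A by (simp add: smult_zero_vec)
    from smult_vec_cancel[OF w(1,2) this] x show False
      by (metis diff_0_right eq_iff_diff_eq_0 of_real_1 of_real_eq_iff not_one_le_zero)
  qed
  with s have s: "0 < s" "s \<le> 1" by auto
  have "complex_of_real (inverse s) * of_real (s * t) = of_real t"
    using \<open>s \<noteq> 0\<close> by (simp add: field_simps)
  then have "of_real t \<cdot>\<^sub>v (map_mat complex_of_real A *\<^sub>v w)
      = of_real (inverse s) \<cdot>\<^sub>v (of_real (s * t) \<cdot>\<^sub>v (map_mat complex_of_real A *\<^sub>v w))"
    by (simp only: smult_smult_assoc)
  also have "\<dots> = (1 - of_real (1 - inverse s * (1 - x))) \<cdot>\<^sub>v w"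
    unfolding ev by (simp add: smult_smult_assoc x)
  finally have "complex_of_real (1 - inverse s * (1 - x)) \<notin> \<real>\<^sub>\<le>\<^sub>0"
    by (rule log_domain_eigenvalue[OF A w(1,2) t])
  moreover have "1 \<le> inverse s * (1 - x)"
    using s x mult_mono[of 1 "inverse s" 1 "1 - x"] by (simp add: one_le_inverse)
  ultimately show False
    by (simp only: nonpos_Reals_of_real_iff)
qed

text \<open>A competing logarithm Y commutes with e^Y = I - tA. For nonzero t it therefore commutes
  with A and with the polynomial X in A, and the complex uniqueness result applies. For t = 0
  nothing is learned about A, but then X = 0 commutes with Y.\<close>

lemma principal_log_eqI:
  assumes A: "A \<in> carrier_mat n n" and X: "X = mat_power_sum n I a A" "finite I"
    and exp: "mat_exp X = 1\<^sub>m n - t \<cdot>\<^sub>m A" and t0: "t = 0 \<Longrightarrow> X = 0\<^sub>m n n"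
    and strip: "\<And>z. z \<in> complex_spectrum X \<Longrightarrow> - pi < Im z \<and> Im z < pi"
  shows "principal_log (1\<^sub>m n - t \<cdot>\<^sub>m A) = X"
proof -
  have Xc: "X \<in> carrier_mat n n" unfolding X(1) by (rule mat_power_sum_carrier[OF A X(2)])
  have dim: "dim_row (1\<^sub>m n - t \<cdot>\<^sub>m A) = n" using A by simp
  show ?thesis
    unfolding principal_log_def dim
  proof (rule the_equality)
    show "X \<in> carrier_mat n n \<and> mat_exp X = 1\<^sub>m n - t \<cdot>\<^sub>m A \<and>
        (\<forall>z\<in>complex_spectrum X. - pi < Im z \<and> Im z < pi)"
      using Xc exp strip by blast
  next
    fix Y assume Y: "Y \<in> carrier_mat n n \<and> mat_exp Y = 1\<^sub>m n - t \<cdot>\<^sub>m A \<and>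
        (\<forall>z\<in>complex_spectrum Y. - pi < Im z \<and> Im z < pi)"
    then have Yc: "Y \<in> carrier_mat n n" by blast
    have "Y * X = X * Y"
    proof (cases "t = 0")
      case True
      then show ?thesis using t0 Yc by simp
    next
      case False
      have "Y * (1\<^sub>m n - t \<cdot>\<^sub>m A) = (1\<^sub>m n - t \<cdot>\<^sub>m A) * Y"
        using mat_exp_commute[OF Yc Yc refl] Y by simp
      then have eq: "Y - t \<cdot>\<^sub>m (Y * A) = Y - t \<cdot>\<^sub>m (A * Y)"
        unfolding mult_minus_distrib_mat[OF Yc one_carrier_mat smult_carrier_mat[OF A]]
          minus_mult_distrib_mat[OF one_carrier_mat smult_carrier_mat[OF A] Yc]
          mult_smult_distrib[OF Yc A] mult_smult_assoc_mat[OF A Yc]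
        using Yc by simp
      have "Y * A = A * Y"
      proof (rule eq_matI)
        fix i j assume "i < dim_row (A * Y)" "j < dim_col (A * Y)"
        then have ij: "i < n" "j < n" using A Yc by auto
        have "(Y - t \<cdot>\<^sub>m (Y * A)) $$ (i, j) = (Y - t \<cdot>\<^sub>m (A * Y)) $$ (i, j)" using eq by simp
        then show "(Y * A) $$ (i, j) = (A * Y) $$ (i, j)"
          using ij False carrier_matD[OF mult_carrier_mat[OF Yc A]] carrier_matD[OF mult_carrier_mat[OF A Yc]]
          by (simp del: index_mult_mat)
      qed (use A Yc in auto)
      then show ?thesis unfolding X(1) by (rule mat_power_sum_commute[OF A X(2) Yc])
    qed
    then have comm: "map_mat complex_of_real X * map_mat of_real Y = map_mat of_real Y * map_mat of_real X"
      by (simp flip: of_real_hom.mat_hom_mult[OF Yc Xc] of_real_hom.mat_hom_mult[OF Xc Yc])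
    have eq: "mat_exp (map_mat complex_of_real Y) = mat_exp (map_mat complex_of_real X)"
      using Y exp by (simp flip: map_mat_mat_exp[OF Xc] map_mat_mat_exp[OF Yc])
    have "map_mat complex_of_real Y = map_mat complex_of_real X"
    proof (rule mat_exp_eq_imp_eq[OF _ _ comm eq])
      show "- pi < Im z \<and> Im z < pi" if "z \<in> complex_spectrum Y \<union> complex_spectrum X" for z
        using that Y strip by blast
    qed (use Xc Yc in simp_all)
    then show "Y = X" by (rule of_real_hom.mat_hom_inj)
  qed
qed

theorem theorem2p1:
  fixes A :: "real mat" and p :: "real poly" and n k :: nat and f :: "real \<Rightarrow> real vec"
  assumes "A \<in> carrier_mat n n"
    and "k \<ge> 2"
    and "monic p" and "degree p = k"
    and "poly_mat p A = 0\<^sub>m n n"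
    and "ivp_solution (log_domain A) (companion_mat p) (- unit_vec k 1) f"
  shows "\<forall>t\<in>log_domain A.
    principal_log (1\<^sub>m n - t \<cdot>\<^sub>m A) = mat_power_sum n {..<k} (\<lambda>i. f t $ i) A"
proof
  fix t assume t: "t \<in> log_domain A"
  note A = assms(1)
  have A': "map_mat complex_of_real A \<in> carrier_mat n n" using A by simp
  have dimC: "dim_row (companion_mat p) = k" using assms(4) by (simp add: companion_mat_def)
  have f0: "f 0 = 0\<^sub>v k"
    using assms(6) by (simp add: ivp_solution_def dimC)
  have "\<forall>s\<in>log_domain A. \<exists>v\<in>carrier_vec k.
      (\<forall>i<k. ((\<lambda>s. f s $ i) has_real_derivative v $ i) (at s within log_domain A)) \<and>
      (1\<^sub>m k - s \<cdot>\<^sub>m companion_mat p) *\<^sub>v v = - unit_vec k 1"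
    using assms(6) by (simp add: ivp_solution_def dimC)
  then obtain v where v: "\<And>s. s \<in> log_domain A \<Longrightarrow> v s \<in> carrier_vec k"
    "\<And>s i. s \<in> log_domain A \<Longrightarrow> i < k \<Longrightarrow>
      ((\<lambda>s. f s $ i) has_real_derivative v s $ i) (at s within log_domain A)"
    "\<And>s. s \<in> log_domain A \<Longrightarrow> (1\<^sub>m k - s \<cdot>\<^sub>m companion_mat p) *\<^sub>v v s = - unit_vec k 1"
    by metis
  have st: "s * t \<in> log_domain A" if "s \<in> {0..1}" for s
    by (rule log_domain_star_shaped[OF A t that])
  have df: "((\<lambda>s. f (s * t) $ i) has_real_derivative v (s * t) $ i * t) (at s within {0..1})"
    if s: "s \<in> {0..1}" and i: "i < k" for s i
  proof -
    \<comment> \<open>Star-shapedness puts the image of [0, 1] under s -> st inside the domain, so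
      the derivative within the domain restricts to that image and the chain rule applies.\<close>
    have "((\<lambda>s. f s $ i) has_real_derivative v (s * t) $ i) (at (s * t) within (\<lambda>s. s * t) ` {0..1})"
      by (rule DERIV_subset[OF v(2)[OF st[OF s] i]]) (use st in auto)
    moreover have "((\<lambda>s. s * t) has_real_derivative t) (at s within {0..1})"
      by (auto intro!: derivative_eq_intros)
    ultimately have "((\<lambda>s. f s $ i) \<circ> (\<lambda>s. s * t) has_real_derivative v (s * t) $ i * t) (at s within {0..1})"
      by (rule DERIV_image_chain)
    then show ?thesis by (simp add: o_def)
  qed
  define X where "X s = mat_power_sum n {..<k} (\<lambda>l. f (s * t) $ l) A" for s
  define V where "V s = mat_power_sum n {..<k} (\<lambda>l. v (s * t) $ l) A" for s
  have X: "X s \<in> carrier_mat n n" and V: "V s \<in> carrier_mat n n" for s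
    unfolding X_def V_def by (simp_all add: mat_power_sum_carrier[OF A])
  have tV: "t \<cdot>\<^sub>m V s \<in> carrier_mat n n" and tA: "t \<cdot>\<^sub>m A \<in> carrier_mat n n" for s
    using V A by simp_all
  have XA: "A * X s = X s * A" for s
    unfolding X_def by (rule mat_power_sum_commute[OF A _ A refl]) simp
  have XX: "X r * X s = X s * X r" for r s
    unfolding X_def[of s] by (rule mat_power_sum_commute[OF A _ X]) (simp_all add: XA)
  have VA: "A * V s = V s * A" for s
    unfolding V_def by (rule mat_power_sum_commute[OF A _ A refl]) simp
  have "V r * X s = X s * V r" for r s
    unfolding X_def by (rule mat_power_sum_commute[OF A _ V]) (simp_all add: VA)
  then have VX: "t \<cdot>\<^sub>m V r * X s = X s * (t \<cdot>\<^sub>m V r)" for r s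
    by (simp add: mult_smult_assoc_mat[OF V X] mult_smult_distrib[OF X V])
  have dX: "mat_has_deriv n X (t \<cdot>\<^sub>m V s) s {0..1}" if s: "s \<in> {0..1}" for s
    unfolding mat_has_deriv_def
  proof (intro allI impI)
    fix i j assume ij: "i < n" "j < n"
    have "((\<lambda>s. \<Sum>l<k. f (s * t) $ l * (A ^\<^sub>m l) $$ (i, j)) has_real_derivative
        (\<Sum>l<k. v (s * t) $ l * t * (A ^\<^sub>m l) $$ (i, j))) (at s within {0..1})"
      by (intro DERIV_sum DERIV_cmult_right df s) auto
    moreover have "(t \<cdot>\<^sub>m V s) $$ (i, j) = (\<Sum>l<k. v (s * t) $ l * t * (A ^\<^sub>m l) $$ (i, j))"
      using ij carrier_matD[OF V] index_mat_power_sum[OF A _ ij, of "{..<k}"]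
      by (simp add: V_def sum_distrib_left ac_simps)
    ultimately show "((\<lambda>s. X s $$ (i, j)) has_real_derivative (t \<cdot>\<^sub>m V s) $$ (i, j)) (at s within {0..1})"
      by (simp add: X_def index_mat_power_sum[OF A _ ij])
  qed
  have ode: "t \<cdot>\<^sub>m V s * (1\<^sub>m n - s \<cdot>\<^sub>m (t \<cdot>\<^sub>m A)) = - (t \<cdot>\<^sub>m A)" if s: "s \<in> {0..1}" for s
  proof -
    have "s \<cdot>\<^sub>m (t \<cdot>\<^sub>m A) = (s * t) \<cdot>\<^sub>m A" by (rule eq_matI) auto
    moreover have "V s * (1\<^sub>m n - (s * t) \<cdot>\<^sub>m A) = - A"
      unfolding V_def by (rule companion_system[OF A assms(2-5) v(1)[OF st[OF s]] v(3)[OF st[OF s]]])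
    ultimately have "t \<cdot>\<^sub>m V s * (1\<^sub>m n - s \<cdot>\<^sub>m (t \<cdot>\<^sub>m A)) = t \<cdot>\<^sub>m (- A)"
      using mult_smult_assoc_mat[OF V minus_carrier_mat[OF smult_carrier_mat[OF A]]] by simp
    also have "\<dots> = - (t \<cdot>\<^sub>m A)" by (rule eq_matI) auto
    finally show ?thesis .
  qed
  have X0: "X 0 = 0\<^sub>m n n"
    using X[of 0] by (intro eq_matI) (auto simp: X_def index_mat_power_sum[OF A] f0)
  have exp_X: "mat_exp (X s) = 1\<^sub>m n - (s * t) \<cdot>\<^sub>m A" if "s \<in> {0..1}" for s
  proof -
    have "s \<cdot>\<^sub>m (t \<cdot>\<^sub>m A) = (s * t) \<cdot>\<^sub>m A" by (rule eq_matI) auto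
    with mat_exp_path[OF X tV tA XX VX dX ode X0 that] show ?thesis by simp
  qed
  have strip: "- pi < Im z \<and> Im z < pi" if z: "z \<in> complex_spectrum (X 1)" for z
  proof -
    let ?X = "\<lambda>s. map_mat complex_of_real (X s)"
    let ?A = "map_mat complex_of_real A"
    have Xc: "?X s \<in> carrier_mat n n" for s using X by simp
    \<comment> \<open>The eigenspace of X(1) for z is invariant under A, hence contains an
      eigenvector of A. Being polynomials in A, all X(s) share that eigenvector.\<close>
    define K where "K = {w \<in> carrier_vec n. ?X 1 *\<^sub>v w = z \<cdot>\<^sub>v w}"
    have K: "K \<subseteq> carrier_vec n" by (auto simp: K_def)
    obtain w0 where w0: "w0 \<in> K" "w0 \<noteq> 0\<^sub>v n"
      using spectrumE[OF z Xc] by (auto simp: K_def)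
    have K_0: "0\<^sub>v n \<in> K" by (simp add: K_def mult_mat_vec_zero[OF Xc] smult_vec_zero)
    have K_smult: "a \<cdot>\<^sub>v w \<in> K" if "w \<in> K" for a w
      using that by (auto simp: K_def mult_mat_vec[OF Xc] smult_smult_assoc mult.commute)
    have K_add: "u + w \<in> K" if "u \<in> K" "w \<in> K" for u w
      using that by (auto simp: K_def mult_add_distrib_mat_vec[OF Xc] smult_add_distrib_vec[of _ n])
    have K_inv: "?A *\<^sub>v w \<in> K" if "w \<in> K" for w
    proof -
      have w: "w \<in> carrier_vec n" "?X 1 *\<^sub>v w = z \<cdot>\<^sub>v w" using that by (auto simp: K_def)
      have "?X 1 * ?A = ?A * ?X 1"
        using XA[of 1] by (simp flip: of_real_hom.mat_hom_mult[OF A X] of_real_hom.mat_hom_mult[OF X A])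
      then have "?X 1 *\<^sub>v (?A *\<^sub>v w) = ?A *\<^sub>v (?X 1 *\<^sub>v w)"
        using assoc_mult_mat_vec[OF Xc A' w(1)] assoc_mult_mat_vec[OF A' Xc w(1)] by metis
      then show ?thesis using A' w by (simp add: K_def mult_mat_vec[OF A' w(1)])
    qed
    obtain w c where w: "w \<in> K" "w \<noteq> 0\<^sub>v n" "?A *\<^sub>v w = c \<cdot>\<^sub>v w"
      by (rule invariant_subspace_eigenvector[OF A' K w0 K_0 K_inv K_smult K_add])
    have w': "w \<in> carrier_vec n" "?X 1 *\<^sub>v w = z \<cdot>\<^sub>v w" using w(1) by (auto simp: K_def)
    \<comment> \<open>The eigenvalue of X(s) at the fixed vector \<open>w\<close>: it starts at 0,
      ends at z and inherits continuity in s from \<open>f\<close>.\<close>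
    define g where "g s = (\<Sum>l<k. complex_of_real (f (s * t) $ l) * c ^ l)" for s
    have Xw: "?X s *\<^sub>v w = g s \<cdot>\<^sub>v w" for s
      unfolding X_def g_def map_mat_mat_power_sum[OF A finite_lessThan]
      by (rule mat_power_sum_mult_eigenvector[OF A' finite_lessThan w'(1) w(3)])
    have "g 1 = z"
      using Xw[of 1] w'(2) by (intro smult_vec_cancel[OF w'(1) w(2)]) simp
    have g0: "g 0 = 0" by (simp add: g_def f0)
    have exp_g: "exp (g s) \<notin> \<real>\<^sub>\<le>\<^sub>0" if s: "s \<in> {0..1}" for s
    proof (rule log_domain_eigenvalue[OF A w'(1) w(2) st[OF s]])
      have "map_mat complex_of_real (1\<^sub>m n - (s * t) \<cdot>\<^sub>m A) *\<^sub>v w = exp (g s) \<cdot>\<^sub>v w"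
        using mat_exp_mult_eigenvector[OF Xc w'(1) Xw[of s]]
        by (simp only: map_mat_mat_exp[OF X, symmetric] exp_X[OF s])
      then show "complex_of_real (s * t) \<cdot>\<^sub>v (?A *\<^sub>v w) = (1 - exp (g s)) \<cdot>\<^sub>v w"
        by (simp only: map_mat_one_minus_smult[OF A] one_minus_smult_mult_vec_iff[OF A' w'(1)])
    qed
    have "continuous_on {0..1} (\<lambda>s. f (s * t) $ l)" if "l < k" for l
      using df[OF _ that] DERIV_continuous unfolding continuous_on_eq_continuous_within by blast
    then have cont: "continuous_on {0..1} (\<lambda>s. \<bar>Im (g s)\<bar>)"
      unfolding g_def by (auto intro!: continuous_intros)
    \<comment> \<open>If the bound failed, the intermediate value theorem would give a time with |Im
      g| = pi; there e^g is a negative real number and an eigenvalue of I - stA, which the domain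
      excludes.\<close>
    have "\<bar>Im z\<bar> < pi"
    proof (rule ccontr)
      assume "\<not> \<bar>Im z\<bar> < pi"
      then obtain s where s: "s \<in> {0..1}" "\<bar>Im (g s)\<bar> = pi"
        using IVT'[of "\<lambda>s. \<bar>Im (g s)\<bar>" 0 pi 1] cont g0 \<open>g 1 = z\<close> by auto
      then have "Im (g s) = pi \<or> Im (g s) = - pi" by linarith
      then have "exp (g s) \<in> \<real>\<^sub>\<le>\<^sub>0"
        by (auto simp: complex_nonpos_Reals_iff Re_exp Im_exp)
      with exp_g[OF s(1)] show False ..
    qed
    then show ?thesis by linarith
  qed
  have "principal_log (1\<^sub>m n - t \<cdot>\<^sub>m A) = X 1"
  proof (rule principal_log_eqI[OF A X_def finite_lessThan])
    show "mat_exp (X 1) = 1\<^sub>m n - t \<cdot>\<^sub>m A" using exp_X[of 1] by simp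
    show "X 1 = 0\<^sub>m n n" if "t = 0" using X0 that by (simp add: X_def)
  qed (rule strip)
  then show "principal_log (1\<^sub>m n - t \<cdot>\<^sub>m A) = mat_power_sum n {..<k} (\<lambda>i. f t $ i) A"
    by (simp add: X_def)
qed

end
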